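(* Let $F=\begin{bmatrix} k & l\\ m & n\end{bmatrix}\in GL(2,\mathbb Z)$ be a hyperbolic matrix with non-negative entries, let $(s_1,s_2)$ and $(u_1,u_2)$ be, respectively, a column and a row eigenvector of $F$ with positive entries, let $e_0=(s_2,u_1)$, $f_0=(-s_1,u_2)$, $L=\mathbb Ze_0+\mathbb Zf_0$, and let $\mathcal F$ be the automorphism of $\mathbb T^2=\mathbb R^2/L$ defined by $F$ in the basis $(e_0,f_0)$. Let $\mathcal T\subset\{a,b\}^{\mathbb Z}$ be the set of (Sturmian) intersection tilings of $\{R_1,R_2\}$, $R_1=[0,s_1]\times[0,u_1]$, $R_2=[-s_2,0]\times[0,u_2]$. Then every substitution $\tau$ on the alphabet $\{a,b\}$ with matrix $F$ which preserves $\mathcal T$ is realized geometrically by a Berg partition: there is a Berg partition for $\mathcal F$ with connectivity matrix $F^T$ whose induced substitution is $\tau$.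
   Context: Matrix convention: $\mathcal F$ is induced by the linear map sending $e_0\mapsto ke_0+mf_0$, $f_0\mapsto le_0+nf_0$. It is diagonal in Cartesian coordinates, contracts the horizontal direction and expands the vertical direction, with positive unstable eigenvalue. Hyperbolic means that no eigenvalue has modulus $1$. Substitutions: a substitution $\tau$ assigns to each of the letters $a,b$ a nonempty finite word in $a,b$, and acts on bi-infinite sequences by concatenation (the result being considered up to shift). It has matrix $F$ if $\tau(a)$ contains $k$ letters $a$ and $m$ letters $b$, and $\tau(b)$ contains $l$ letters $a$ and $n$ letters $b$. It preserves $\mathcal T$ if it maps every sequence of $\mathcal T$ to a sequence of $\mathcal T$ (up to shift). Intersection tilings $\mathcal T$: the $L$-translates of $R_1,R_2$ tile the plane. For a vertical line $\ell$ containing no point of $L$, these rectangles cut $\ell$ into segments; reading upwards and writing $a$ for a segment in a translate of $R_1$ and $b$ for a segment in a translate of $R_2$ gives a sequence in $\{a,b\}^{\mathbb Z}$. If $\ell$ contains a point $z\in L$, then $\ell$ contains the common vertical side segment $z+\{0\}\times[0,u_1+u_2]$ and there are two tilings of $\ell$, equal outside of this segment, the segment being read as $ab$ (rectangles on the right) or $ba$ (rectangles on the left). $\mathcal T$ is the set of all sequences so obtained, with all their shifts. Bi-partition: let $s_1',s_2',u_1',u_2'>0$ be such that $(s_2',u_1')$ and $(-s_1',u_2')$ form a basis of $L$, and let $z\in\mathbb R^2$. Then $Q_1=z+[0,s_1']\times[0,u_1']$ and $Q_2=z+[-s_2',0]\times[0,u_2']$ project to a partition of $\mathbb T^2$, called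 a bi-partition, with horizontal spine $J^s=z+[-s_2',s_1']\times\{0\}$ and vertical spine $J^u=z+\{0\}\times[0,u_1'+u_2']$ (projected to $\mathbb T^2$). It is a Berg partition for $\mathcal F$ if $\mathcal F(J^s)\subset J^s$ and $\mathcal F(J^u)\supset J^u$. Its connectivity matrix has $(i,j)$ entry equal to the number of connected components of $\mathcal F(\operatorname{int}Q_i)\cap\operatorname{int}Q_j$. Induced substitution of a Berg partition $\{Q_1,Q_2\}$: take a vertical segment crossing $Q_1$ from bottom to top through its interior; its image under $\mathcal F$, traversed upwards, crosses a finite succession of rectangles $Q_1$, $Q_2$ completely from bottom to top; recording $a$ for $Q_1$ and $b$ for $Q_2$ gives a word $w_1$ which does not depend on the segment. Define $w_2$ in the same way from $Q_2$. The induced substitution is $a\mapsto w_1$, $b\mapsto w_2$. *)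

theory Defs
  imports "HOL-Analysis.Analysis"
begin

section \<open>Matrices\<close>

text \<open>\<^term>\<open>invertible\<close> at type \<open>int ^ 2 ^ 2\<close> asks for an inverse with integer entries,
  so it describes membership in $GL(2,Z)$.\<close>

definition hyperbolic :: "int ^ 2 ^ 2 \<Rightarrow> bool" where
  "hyperbolic F \<longleftrightarrow>
    (\<forall>(\<mu>::complex) v. v \<noteq> 0 \<longrightarrow> map_matrix of_int F *v v = \<mu> *s v \<longrightarrow> cmod \<mu> \<noteq> 1)"

definition column_eigenvector :: "int ^ 2 ^ 2 \<Rightarrow> real ^ 2 \<Rightarrow> bool" where
  "column_eigenvector F v \<longleftrightarrow> v \<noteq> 0 \<and> (\<exists>\<mu>. map_matrix of_int F *v v = \<mu> *s v)"

definition row_eigenvector :: "int ^ 2 ^ 2 \<Rightarrow> real ^ 2 \<Rightarrow> bool" where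
  "row_eigenvector F v \<longleftrightarrow> v \<noteq> 0 \<and> (\<exists>\<mu>. v v* map_matrix of_int F = \<mu> *s v)"


section \<open>The lattice and the torus\<close>

definition e_vec :: "real ^ 2 \<Rightarrow> real ^ 2 \<Rightarrow> real \<times> real" where
  "e_vec s u = (s $ 2, u $ 1)"

definition f_vec :: "real ^ 2 \<Rightarrow> real ^ 2 \<Rightarrow> real \<times> real" where
  "f_vec s u = (- s $ 1, u $ 2)"

definition int_span :: "real \<times> real \<Rightarrow> real \<times> real \<Rightarrow> (real \<times> real) set" where
  "int_span e f = {of_int i *\<^sub>R e + of_int j *\<^sub>R f | i j. True}"

definition lattice_basis :: "(real \<times> real) set \<Rightarrow> real \<times> real \<Rightarrow> real \<times> real \<Rightarrow> bool" where
  "lattice_basis L e f \<longleftrightarrow> int_span e f = L \<and>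
    (\<forall>i j. of_int i *\<^sub>R e + of_int j *\<^sub>R f = 0 \<longrightarrow> i = 0 \<and> j = 0)"

text \<open>Points of the torus $R^2/L$ are the cosets of \<open>L\<close>.  A linear map \<open>A\<close> with
  \<open>A ` L = L\<close> induces on cosets the map \<open>C \<mapsto> A ` C\<close>.\<close>

definition torus_proj :: "(real \<times> real) set \<Rightarrow> real \<times> real \<Rightarrow> (real \<times> real) set" where
  "torus_proj L p = (+) p ` L"

definition torus_map ::
    "(real \<times> real \<Rightarrow> real \<times> real) \<Rightarrow> (real \<times> real) set \<Rightarrow> (real \<times> real) set" where
  "torus_map A C = A ` C"

definition torus_topology :: "(real \<times> real) set \<Rightarrow> (real \<times> real) set topology" where
  "torus_topology L =
    topology (\<lambda>U. U \<subseteq> range (torus_proj L) \<and> open (torus_proj L -` U))"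

lemma openin_torus_topology:
  "openin (torus_topology L) U \<longleftrightarrow> U \<subseteq> range (torus_proj L) \<and> open (torus_proj L -` U)"
proof -
  have "istopology (\<lambda>U. U \<subseteq> range (torus_proj L) \<and> open (torus_proj L -` U))"
    unfolding istopology_def by (auto simp: vimage_Union open_Int)
  then show ?thesis
    by (simp add: torus_topology_def)
qed


section \<open>Rectangles and bi-partitions\<close>

text \<open>The index type \<open>2\<close>, with its elements 1 and 2, indexes rows and columns of matrices,
  the two rectangles, and the alphabet: \<open>a\<close> is 1 and \<open>b\<close> is 2.\<close>

type_synonym letter = "2"

definition rect :: "real ^ 2 \<Rightarrow> real ^ 2 \<Rightarrow> letter \<Rightarrow> (real \<times> real) set" where
  "rect s u i = (if i = 1 then {0..s $ 1} \<times> {0..u $ 1} else {- s $ 2..0} \<times> {0..u $ 2})"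

definition bi_partition_data :: "(real \<times> real) set \<Rightarrow> real ^ 2 \<Rightarrow> real ^ 2 \<Rightarrow> bool" where
  "bi_partition_data L s u \<longleftrightarrow>
    (\<forall>i. 0 < s $ i) \<and> (\<forall>i. 0 < u $ i) \<and> lattice_basis L (e_vec s u) (f_vec s u)"

definition bi_rect :: "real ^ 2 \<Rightarrow> real ^ 2 \<Rightarrow> real \<times> real \<Rightarrow> letter \<Rightarrow> (real \<times> real) set" where
  "bi_rect s u z i = (+) z ` rect s u i"

definition horizontal_spine :: "real ^ 2 \<Rightarrow> real \<times> real \<Rightarrow> (real \<times> real) set" where
  "horizontal_spine s z = (+) z ` ({- s $ 2..s $ 1} \<times> {0})"

definition vertical_spine :: "real ^ 2 \<Rightarrow> real \<times> real \<Rightarrow> (real \<times> real) set" where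
  "vertical_spine u z = (+) z ` ({0} \<times> {0..u $ 1 + u $ 2})"

definition berg_partition ::
    "(real \<times> real) set \<Rightarrow> (real \<times> real \<Rightarrow> real \<times> real) \<Rightarrow>
     real ^ 2 \<Rightarrow> real ^ 2 \<Rightarrow> real \<times> real \<Rightarrow> bool" where
  "berg_partition L A s u z \<longleftrightarrow> bi_partition_data L s u \<and>
    torus_map A ` torus_proj L ` horizontal_spine s z \<subseteq> torus_proj L ` horizontal_spine s z \<and>
    torus_proj L ` vertical_spine u z \<subseteq> torus_map A ` torus_proj L ` vertical_spine u z"

text \<open>Interiors are those of the rectangles in the plane, then projected: the interior of the
  projected closed rectangle can be larger, since a rectangle may be adjacent to its own translate.\<close>

definition image_components ::
    "(real \<times> real) set \<Rightarrow> (real \<times> real \<Rightarrow> real \<times> real) \<Rightarrow>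
     (letter \<Rightarrow> (real \<times> real) set) \<Rightarrow> letter \<Rightarrow> letter \<Rightarrow> (real \<times> real) set set set" where
  "image_components L A Q i j = connected_components_of (subtopology (torus_topology L)
     (torus_map A ` torus_proj L ` interior (Q i) \<inter> torus_proj L ` interior (Q j)))"

text \<open>Finiteness is required separately since \<^term>\<open>card\<close> is 0 on infinite sets.\<close>

definition has_connectivity_matrix ::
    "(real \<times> real) set \<Rightarrow> (real \<times> real \<Rightarrow> real \<times> real) \<Rightarrow>
     (letter \<Rightarrow> (real \<times> real) set) \<Rightarrow> int ^ 2 ^ 2 \<Rightarrow> bool" where
  "has_connectivity_matrix L A Q C \<longleftrightarrow>
    (\<forall>i j. finite (image_components L A Q i j) \<and>
           int (card (image_components L A Q i j)) = C $ i $ j)"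


section \<open>Substitutions\<close>

definition substitution :: "(letter \<Rightarrow> letter list) \<Rightarrow> bool" where
  "substitution \<tau> \<longleftrightarrow> (\<forall>x. \<tau> x \<noteq> [])"

definition has_matrix :: "(letter \<Rightarrow> letter list) \<Rightarrow> int ^ 2 ^ 2 \<Rightarrow> bool" where
  "has_matrix \<tau> F \<longleftrightarrow> (\<forall>i j. int (count_list (\<tau> j) i) = F $ i $ j)"

text \<open>\<open>w'\<close> is the concatenation of the words \<open>\<tau> (w i)\<close>, the \<open>i\<close>-th of which occupies the
  positions from \<open>p i\<close> up to \<open>p (i + 1) - 1\<close>; \<open>p 0\<close> is arbitrary, so \<open>w'\<close> is determined
  only up to shift.\<close>

definition subst_image ::
    "(letter \<Rightarrow> letter list) \<Rightarrow> (int \<Rightarrow> letter) \<Rightarrow> (int \<Rightarrow> letter) \<Rightarrow> bool" where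
  "subst_image \<tau> w w' \<longleftrightarrow> (\<exists>p :: int \<Rightarrow> int. \<forall>i.
     p (i + 1) = p i + int (length (\<tau> (w i))) \<and>
     (\<forall>j < length (\<tau> (w i)). w' (p i + int j) = \<tau> (w i) ! j))"

definition preserves :: "(letter \<Rightarrow> letter list) \<Rightarrow> (int \<Rightarrow> letter) set \<Rightarrow> bool" where
  "preserves \<tau> T \<longleftrightarrow> (\<forall>w\<in>T. \<exists>w'\<in>T. subst_image \<tau> w w')"


section \<open>Intersection tilings\<close>

text \<open>The line \<open>{c} \<times> UNIV\<close> is cut into segments with endpoints \<open>y i\<close>, the \<open>i\<close>-th one being the
  intersection with a translate of the rectangle of index \<open>w i\<close>.  If the line contains a lattice
  point \<open>z\<close>, the vertical side segment above \<open>z\<close> is read as \<open>ab\<close> or as \<open>ba\<close>.  The indexing of the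
  segments is arbitrary, so the set is closed under shifts.\<close>

definition intersection_tilings ::
    "(real \<times> real) set \<Rightarrow> real ^ 2 \<Rightarrow> real ^ 2 \<Rightarrow> (int \<Rightarrow> letter) set" where
  "intersection_tilings L s u = {w. \<exists>c (y :: int \<Rightarrow> real).
     strict_mono y \<and> (\<Union>i. {y i..y (i + 1)}) = UNIV \<and>
     (\<forall>i. \<exists>v\<in>L. {c} \<times> {y i..y (i + 1)} = ({c} \<times> UNIV) \<inter> (+) v ` rect s u (w i)) \<and>
     (\<forall>z\<in>L. fst z = c \<longrightarrow> (\<exists>i. y i = snd z \<and> y (i + 2) = snd z + (u $ 1 + u $ 2) \<and>
        (w i = 1 \<and> w (i + 1) = 2 \<or> w i = 2 \<and> w (i + 1) = 1)))}"


section \<open>The substitution induced by a Berg partition\<close>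

text \<open>The vertical segment with abscissa \<open>c\<close> and ordinates from \<open>\<alpha>\<close> to \<open>\<beta>\<close> crosses the rectangle
  \<open>R\<close> from bottom to top through its interior.\<close>

definition crosses :: "real \<Rightarrow> real \<Rightarrow> real \<Rightarrow> (real \<times> real) set \<Rightarrow> bool" where
  "crosses c \<alpha> \<beta> R \<longleftrightarrow> \<alpha> < \<beta> \<and> {c} \<times> {\<alpha>..\<beta>} = ({c} \<times> UNIV) \<inter> R \<and>
    {c} \<times> {\<alpha><..<\<beta>} \<subseteq> interior R"

text \<open>Successions of rectangles in the torus are read in the plane, through \<open>L\<close>-translates.\<close>

definition crossing_word ::
    "(real \<times> real) set \<Rightarrow> (letter \<Rightarrow> (real \<times> real) set) \<Rightarrow>
     real \<Rightarrow> real \<Rightarrow> real \<Rightarrow> letter list \<Rightarrow> bool" where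
  "crossing_word L Q c \<alpha> \<beta> w \<longleftrightarrow> (\<exists>h :: nat \<Rightarrow> real. h 0 = \<alpha> \<and> h (length w) = \<beta> \<and>
     (\<forall>j < length w. \<exists>v\<in>L. crosses c (h j) (h (Suc j)) ((+) v ` Q (w ! j))))"

definition induces_substitution ::
    "(real \<times> real) set \<Rightarrow> (real \<times> real \<Rightarrow> real \<times> real) \<Rightarrow>
     (letter \<Rightarrow> (real \<times> real) set) \<Rightarrow> (letter \<Rightarrow> letter list) \<Rightarrow> bool" where
  "induces_substitution L A Q \<tau> \<longleftrightarrow> (\<forall>i c \<alpha> \<beta>. crosses c \<alpha> \<beta> (Q i) \<longrightarrow>
     (\<exists>c' \<alpha>' \<beta>'. \<alpha>' < \<beta>' \<and> A ` ({c} \<times> {\<alpha>..\<beta>}) = {c'} \<times> {\<alpha>'..\<beta>'} \<and>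
        crossing_word L Q c' \<alpha>' \<beta>' (\<tau> i)))"

end

theory Submission
  imports Defs
begin

text \<open>
  The bi-partition that realizes \<open>\<tau>\<close> has the sides of \<open>R\<^sub>1\<close> and \<open>R\<^sub>2\<close> themselves; only its corner
  \<open>z\<close> has to be found.  Since \<open>(s $ 2, - s $ 1)\<close> and \<open>u\<close> are row eigenvectors of \<open>F\<close>, the map is
  \<open>A (x, y) = (\<kappa> * x, \<mu> * y)\<close>.

  Following a vertical line upwards and noting its abscissa relative to the rectangle being crossed
  gives an orbit of the exchange of the intervals \<open>[0, s\<^sub>1]\<close> (letter \<open>a\<close>, shift by \<open>- s\<^sub>2\<close>) and
  \<open>[- s\<^sub>2, 0]\<close> (letter \<open>b\<close>, shift by \<open>s\<^sub>1\<close>), and the intersection tilings are the codings of these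
  orbits.  Reading \<open>\<tau> x\<close> shifts the abscissa by \<open>\<kappa>\<close> times the shift of the letter \<open>x\<close>, because \<open>\<tau>\<close>
  has matrix \<open>F\<close>.  So if \<open>\<tau>\<close> maps the coding of the orbit of 0 to another coding, the new orbit,
  sampled at the beginnings of the substituted letters, is the image of the old one under a single
  affine map \<open>t \<mapsto> C + \<kappa> * t\<close>.  By density, \<open>\<tau> x\<close> is the word read upwards from \<open>C + \<kappa> * t\<close> for every
  \<open>t\<close> in the interval of \<open>x\<close> (lemma \<open>itinerary\<close>).

  The constant \<open>C\<close> is not arbitrary.  Both \<open>\<tau> a \<tau> b\<close> and \<open>\<tau> b \<tau> a\<close> are read from \<open>C\<close>, and they
  differ, since commuting words would have proportional letter counts while \<open>F\<close> is invertible.  The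
  exchange is ambiguous only at 0, so at their first difference the path passes through a point \<open>p\<close>
  of the lattice; therefore \<open>C = fst p\<close>, and the vertical side above \<open>p\<close> ends no higher than
  \<open>\<mu> * (u\<^sub>1 + u\<^sub>2)\<close> (lemma \<open>branch_point\<close>).

  Now take \<open>z\<close> with \<open>A z + p = z + (fst p, 0)\<close>.  Modulo \<open>p\<close>, the map \<open>A\<close> acts on the horizontal spine
  as \<open>t \<mapsto> C + \<kappa> * t\<close>, so the spine is mapped into itself and the words that the image rectangles cross
  are \<open>\<tau> a\<close> and \<open>\<tau> b\<close>.  The bounds on the height of \<open>p\<close> say that the image of the vertical spine
  contains the spine.  Finally, the pieces into which the horizontal edges cut an image rectangle are
  disjoint in the torus, open and connected, one for each letter of the word, which gives the
  connectivity matrix (lemma \<open>image_components\<close>).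
\<close>

section \<open>Lattice vectors and rectangles\<close>

lemma letter_cases: "(x :: letter) = 1 \<or> x = 2"
  by (rule exhaust_2)

lemma mem_translate: "t \<in> (+) v ` S \<longleftrightarrow> t - v \<in> S" for t v :: "'b :: ab_group_add"
  by (auto simp: image_iff algebra_simps) (metis add.commute diff_add_cancel)

locale two_rectangles =
  fixes s u :: "real ^ 2"
  assumes s_pos: "\<And>i. 0 < s $ i" and u_pos: "\<And>i. 0 < u $ i"
begin

abbreviation lattice :: "(real \<times> real) set" where
  "lattice \<equiv> int_span (e_vec s u) (f_vec s u)"

definition step :: "letter \<Rightarrow> real \<times> real" where
  "step x = (if x = 1 then e_vec s u else f_vec s u)"

text \<open>A vertical line that crosses the translate of rectangle \<open>x\<close> with corner \<open>v\<close> goes on through the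
translate with corner \<open>v + step x\<close>.  Hence the displacement of a word is the difference of the
corners at the two ends of any vertical path that reads it.\<close>

definition displacement :: "letter list \<Rightarrow> real \<times> real" where
  "displacement w = sum_list (map step w)"

definition base :: "letter \<Rightarrow> real set" where
  "base x = (if x = 1 then {0..s $ 1} else {- s $ 2..0})"

definition open_base :: "letter \<Rightarrow> real set" where
  "open_base x = (if x = 1 then {0<..<s $ 1} else {- s $ 2<..<0})"

lemma fst_step: "fst (step x) = (if x = 1 then s $ 2 else - s $ 1)"
  by (simp add: step_def e_vec_def f_vec_def)

lemma snd_step [simp]: "snd (step x) = u $ x"
  using letter_cases[of x] by (auto simp: step_def e_vec_def f_vec_def)

lemma rect_eq: "rect s u x = base x \<times> {0..u $ x}"
  using letter_cases[of x] by (auto simp: rect_def base_def)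

lemma open_base_subset: "open_base x \<subseteq> base x"
  by (auto simp: open_base_def base_def)

lemma interior_base: "interior (base x) = open_base x"
  by (simp add: base_def open_base_def)

lemma interior_rect: "interior (rect s u x) = open_base x \<times> {0<..<u $ x}"
  by (simp add: rect_eq interior_Times interior_base)

lemma closed_base: "closed (base x)"
  by (simp add: base_def)

lemma base_Un: "base 1 \<union> base 2 = {- s $ 2..s $ 1}"
  using s_pos[of 1] s_pos[of 2] by (auto simp: base_def)

lemma base_subset: "base x \<subseteq> {- s $ 2..s $ 1}"
  using letter_cases[of x] base_Un by auto

lemma zero_in_base: "0 \<in> base x"
  using s_pos[of 1] s_pos[of 2] by (simp add: base_def)

lemma lattice_iff:
  "v \<in> lattice \<longleftrightarrow> (\<exists>i j. v = of_int i *\<^sub>R e_vec s u + of_int j *\<^sub>R f_vec s u)"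
  by (auto simp: int_span_def)

lemma lattice_0: "0 \<in> lattice"
  unfolding lattice_iff by (rule exI[of _ 0], rule exI[of _ 0]) simp

lemma lattice_diff:
  assumes "v \<in> lattice" "v' \<in> lattice"
  shows "v - v' \<in> lattice"
proof -
  obtain i j i' j' where "v = of_int i *\<^sub>R e_vec s u + of_int j *\<^sub>R f_vec s u"
    "v' = of_int i' *\<^sub>R e_vec s u + of_int j' *\<^sub>R f_vec s u"
    using assms unfolding lattice_iff by blast
  then have "v - v' = of_int (i - i') *\<^sub>R e_vec s u + of_int (j - j') *\<^sub>R f_vec s u"
    by (simp add: algebra_simps)
  then show ?thesis unfolding lattice_iff by blast
qed

lemma lattice_uminus: "v \<in> lattice \<Longrightarrow> - v \<in> lattice"
  using lattice_diff[OF lattice_0] by simp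

lemma lattice_add: "v \<in> lattice \<Longrightarrow> v' \<in> lattice \<Longrightarrow> v + v' \<in> lattice"
  using lattice_diff[OF _ lattice_uminus, of v v'] by simp

lemma step_in_lattice: "step x \<in> lattice"
proof -
  have "step x = of_int (if x = 1 then 1 else 0) *\<^sub>R e_vec s u
      + of_int (if x = 1 then 0 else 1) *\<^sub>R f_vec s u"
    by (simp add: step_def)
  then show ?thesis unfolding lattice_iff by blast
qed

lemma displacement_simps [simp]:
  "displacement [] = 0"
  "displacement (x # w) = step x + displacement w"
  "displacement (w @ w') = displacement w + displacement w'"
  by (simp_all add: displacement_def)

lemma displacement_take_Suc:
  "q < length w \<Longrightarrow> displacement (take (Suc q) w) = displacement (take q w) + step (w ! q)"
  by (simp add: take_Suc_conv_app_nth)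

lemma displacement_in_lattice: "displacement w \<in> lattice"
  by (induction w) (auto intro: lattice_0 lattice_add step_in_lattice)

lemma displacement_count:
  "displacement w = real (count_list w 1) *\<^sub>R step 1 + real (count_list w 2) *\<^sub>R step 2"
proof (induction w)
  case (Cons x w)
  then show ?case
    using letter_cases[of x] by (auto simp: algebra_simps)
qed simp

lemma snd_displacement_nonneg: "0 \<le> snd (displacement w)"
  by (induction w) (auto intro: add_nonneg_nonneg less_imp_le[OF u_pos])

lemma fst_lattice: "fst (of_int i *\<^sub>R e_vec s u + of_int j *\<^sub>R f_vec s u) = i * s $ 2 - j * s $ 1"
  and snd_lattice: "snd (of_int i *\<^sub>R e_vec s u + of_int j *\<^sub>R f_vec s u) = i * u $ 1 + j * u $ 2"
  by (simp_all add: e_vec_def f_vec_def)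

text \<open>A nonzero lattice vector is long in one of the two directions.  When \<open>p\<close> and \<open>q\<close> have opposite
signs the horizontal contributions of \<open>e\<close> and \<open>f\<close> reinforce each other, and otherwise the vertical
ones do.\<close>

lemma lattice_vector_cases:
  fixes p q :: int
  defines "X \<equiv> p * s $ 2 - q * s $ 1" and "Y \<equiv> p * u $ 1 + q * u $ 2"
  shows "p = 0 \<and> q = 0 \<or> s $ 1 + s $ 2 \<le> \<bar>X\<bar>
    \<or> (u $ 1 \<le> Y \<and> u $ 2 \<le> Y) \<or> (u $ 1 \<le> Y \<and> s $ 2 \<le> X) \<or> (u $ 2 \<le> Y \<and> X \<le> - s $ 1)
    \<or> (Y \<le> - u $ 1 \<and> Y \<le> - u $ 2) \<or> (Y \<le> - u $ 1 \<and> X \<le> - s $ 2) \<or> (Y \<le> - u $ 2 \<and> s $ 1 \<le> X)"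
proof -
  have ge: "1 \<le> r \<Longrightarrow> t \<le> r * t" and le: "r \<le> -1 \<Longrightarrow> r * t \<le> - t"
    if "0 < t" for r :: int and t :: real
    using that mult_right_mono[of 1 "real_of_int r" t] mult_right_mono[of "real_of_int r" "-1" t]
    by auto
  note g = ge[OF s_pos[of 1]] ge[OF s_pos[of 2]] ge[OF u_pos[of 1]] ge[OF u_pos[of 2]]
    and l = le[OF s_pos[of 1]] le[OF s_pos[of 2]] le[OF u_pos[of 1]] le[OF u_pos[of 2]]
    and pos = s_pos[of 1] s_pos[of 2] u_pos[of 1] u_pos[of 2]
  consider "p = 0" "q = 0" | "p = 0" "1 \<le> q" | "p = 0" "q \<le> -1"
    | "1 \<le> p" "q = 0" | "1 \<le> p" "1 \<le> q" | "1 \<le> p" "q \<le> -1"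
    | "p \<le> -1" "q = 0" | "p \<le> -1" "1 \<le> q" | "p \<le> -1" "q \<le> -1"
  proof -
    have "r \<le> -1 \<or> r = 0 \<or> 1 \<le> r" for r :: int by linarith
    from this[of p] this[of q] that show thesis by blast
  qed
  then show ?thesis
  proof cases
    case 5
    then show ?thesis using g[of p] g[of q] pos unfolding Y_def by linarith
  next
    case 6
    then show ?thesis using g[of p] l[of q] pos unfolding X_def by linarith
  next
    case 8
    then show ?thesis using l[of p] g[of q] pos unfolding X_def by linarith
  next
    case 9
    then show ?thesis using l[of p] l[of q] pos unfolding Y_def by linarith
  qed (use g[of p] g[of q] l[of p] l[of q] in \<open>auto simp: X_def Y_def\<close>)
qed

text \<open>This is the disjointness half of the tiling property.  The bottom edges are included, so that a
point on a horizontal edge is never in the interior of another translate; this is what separates the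
pieces of an image rectangle that are stacked on top of each other.\<close>

lemma translate_unique:
  assumes "v \<in> lattice" "v' \<in> lattice"
    and x: "X - fst v \<in> open_base i" and x': "X - fst v' \<in> open_base j"
    and y: "Y - snd v \<in> {0..<u $ i}" and y': "Y - snd v' \<in> {0..<u $ j}"
  shows "v = v' \<and> i = j"
proof -
  obtain p q where pq: "v - v' = of_int p *\<^sub>R e_vec s u + of_int q *\<^sub>R f_vec s u"
    using lattice_diff[OF assms(1,2)] unfolding lattice_iff by blast
  have X: "fst v - fst v' = p * s $ 2 - q * s $ 1" and Y: "snd v - snd v' = p * u $ 1 + q * u $ 2"
    using fst_lattice[of p q] snd_lattice[of p q] by (simp_all flip: pq)
  define dx dy where d: "dx = fst v - fst v'" "dy = snd v - snd v'"
  note c = lattice_vector_cases[of p q, folded X Y, folded d]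
  have dy: "dy < u $ j" "- u $ i < dy"
    using y y' by (auto simp: d)
  note pos = s_pos[of 1] s_pos[of 2] u_pos[of 1] u_pos[of 2]
  consider "i = 1" "j = 1" | "i = 1" "j = 2" | "i = 2" "j = 1" | "i = 2" "j = 2"
    using letter_cases[of i] letter_cases[of j] by blast
  then have "p = 0 \<and> q = 0 \<and> i = j"
  proof cases
    case 1
    then have "dx < s $ 1" "- s $ 1 < dx"
      using x x' by (auto simp: open_base_def d)
    then show ?thesis using 1 c dy pos by (simp; argo)
  next
    case 2
    then have "dx < 0" "- s $ 1 - s $ 2 < dx"
      using x x' by (auto simp: open_base_def d)
    then show ?thesis using 2 c dy pos X by (simp flip: d; argo)
  next
    case 3
    then have "0 < dx" "dx < s $ 1 + s $ 2"
      using x x' by (auto simp: open_base_def d)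
    then show ?thesis using 3 c dy pos X by (simp flip: d; argo)
  next
    case 4
    then have "dx < s $ 2" "- s $ 2 < dx"
      using x x' by (auto simp: open_base_def d)
    then show ?thesis using 4 c dy pos by (simp; argo)
  qed
  then show ?thesis using pq by simp
qed

lemma lattice_basis: "lattice_basis lattice (e_vec s u) (f_vec s u)"
  unfolding lattice_basis_def
proof (intro conjI allI impI refl)
  fix i j
  assume 0: "of_int i *\<^sub>R e_vec s u + of_int j *\<^sub>R f_vec s u = 0"
  have "i * s $ 2 - j * s $ 1 = 0" "i * u $ 1 + j * u $ 2 = 0"
    using fst_lattice[of i j] snd_lattice[of i j] by (simp_all add: 0)
  then have "i = 0 \<and> j = 0"
    using lattice_vector_cases[of i j] s_pos[of 1] s_pos[of 2] u_pos[of 1] u_pos[of 2] by auto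
  then show "i = 0" "j = 0" by auto
qed

lemma rect_section:
  "({c} \<times> UNIV) \<inter> (+) v ` rect s u x =
    (if c - fst v \<in> base x then {c} \<times> {snd v..snd v + u $ x} else {})"
  by (cases v) (auto simp: mem_translate rect_eq minus_prod_def)

section \<open>Intersection tilings as itineraries\<close>

text \<open>The segments of a tiled line belong to translates whose corners are consecutive: the next corner has
the height at which the present segment ends, and a lattice vector is determined by its height.
Measured from the corners, the abscissae \<open>c - fst (v i)\<close> form an orbit of the exchange of the two
intervals \<open>base 1\<close> and \<open>base 2\<close>, and the tiling is its coding.\<close>

lemma tiling_itinerary:
  assumes snd_inj: "\<And>v. v \<in> lattice \<Longrightarrow> snd v = 0 \<Longrightarrow> v = 0"
    and w: "w \<in> intersection_tilings lattice s u"
  obtains c v where "\<And>i. v (i + 1) = v i + step (w i)" "\<And>i. c - fst (v i) \<in> base (w i)"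
proof -
  obtain c y where mono: "strict_mono (y :: int \<Rightarrow> real)"
    and cut: "\<And>i. \<exists>v\<in>lattice. {c} \<times> {y i..y (i + 1)} = ({c} \<times> UNIV) \<inter> (+) v ` rect s u (w i)"
    using w unfolding intersection_tilings_def by blast
  obtain v where v: "\<And>i. v i \<in> lattice"
    and cut: "\<And>i. {c} \<times> {y i..y (i + 1)} = ({c} \<times> UNIV) \<inter> (+) (v i) ` rect s u (w i)"
    using cut by metis
  have less: "y i < y (i + 1)" for i
    using mono by (simp add: strict_mono_def)
  have x: "c - fst (v i) \<in> base (w i)" and "{y i..y (i + 1)} = {snd (v i)..snd (v i) + u $ w i}" for i
    using cut[of i] less[of i] by (auto simp: rect_section times_eq_iff split: if_splits)
  then have y: "y i = snd (v i)" "y (i + 1) = snd (v i) + u $ w i" for i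
    using less[of i] u_pos[of "w i"] by (metis Icc_eq_Icc less_eq_real_def)+
  have "v (i + 1) - (v i + step (w i)) = 0" for i
    using y(1)[of "i + 1"] y(2)[of i]
    by (intro snd_inj lattice_diff lattice_add v step_in_lattice) simp
  then have "v (i + 1) = v i + step (w i)" for i
    by (metis right_minus_eq)
  then show thesis using x by (rule that)
qed

lemma tiling_word:
  assumes v: "\<And>i. v (i + 1) = v i + step (w i)"
    and word: "\<And>q. q < length x \<Longrightarrow> w (p + int q) = x ! q"
    and "q \<le> length x"
  shows "v (p + int q) = v p + displacement (take q x)"
  using \<open>q \<le> length x\<close>
proof (induction q)
  case (Suc q)
  then show ?case
    using v[of "p + int q"] word[of q] by (simp add: displacement_take_Suc algebra_simps)
qed simp

lemma segments_cover_line: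
  fixes y :: "int \<Rightarrow> real"
  assumes d: "0 < d" and gap: "\<And>i. y i + d \<le> y (i + 1)"
  shows "(\<Union>i. {y i..y (i + 1)}) = UNIV"
proof -
  have cover: "{y (- int n)..y (int n)} \<subseteq> (\<Union>i. {y i..y (i + 1)})" for n
  proof (induction n)
    case 0
    show ?case using gap[of 0] d by force
  next
    case (Suc n)
    have "{y (- int (Suc n))..y (int (Suc n))} \<subseteq>
        {y (- int (Suc n))..y (- int (Suc n) + 1)} \<union> {y (- int n)..y (int n)} \<union> {y (int n)..y (int n + 1)}"
      by (auto simp: add.commute)
    with Suc show ?case by blast
  qed
  have far: "y 0 + real n * d \<le> y (int n) \<and> y (- int n) + real n * d \<le> y 0" for n
  proof (induction n)
    case (Suc n)
    then show ?case
      using gap[of "int n"] gap[of "- int (Suc n)"] by (simp add: algebra_simps)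
  qed simp
  have "t \<in> (\<Union>i. {y i..y (i + 1)})" for t
  proof -
    obtain n where "\<bar>t - y 0\<bar> / d < real n"
      using reals_Archimedean2 by blast
    then have "\<bar>t - y 0\<bar> < real n * d"
      using d by (simp add: field_simps)
    with far[of n] have "t \<in> {y (- int n)..y (int n)}" by auto
    then show ?thesis using cover by blast
  qed
  then show ?thesis by blast
qed

text \<open>The orbit of 0 under the interval exchange is written down with the floor function, since the
exchange is the rotation by \<open>s $ 1\<close> of a circle of length \<open>s $ 1 + s $ 2\<close>.  Kronecker's theorem makes
it dense.  The singular point 0 is a convenient start: no generic line has to be chosen, and the
orbit is sampled by an affine map without correction terms.\<close>

lemma tiling_through_origin:
  assumes fst_inj: "\<And>v. v \<in> lattice \<Longrightarrow> fst v = 0 \<Longrightarrow> v = 0"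
  obtains w v where "w \<in> intersection_tilings lattice s u"
    and "v 0 = 0" "\<And>i. v (i + 1) = v i + step (w i)"
    and "\<And>x. base x \<subseteq> closure {- fst (v i) | i. w i = x}"
proof -
  define \<Theta> where "\<Theta> = s $ 1 + s $ 2"
  define N where "N i = \<lfloor>(s $ 2 + of_int i * s $ 1) / \<Theta>\<rfloor>" for i :: int
  define v where "v i = of_int (N i) *\<^sub>R e_vec s u + of_int (i - N i) *\<^sub>R f_vec s u" for i
  define w :: "int \<Rightarrow> letter" where "w i = (if N (i + 1) = N i + 1 then 1 else 2)" for i
  \<comment> \<open>\<open>N i\<close> counts the letters 1 among the first \<open>i\<close> letters of the coding.\<close>
  note pos = s_pos[of 1] s_pos[of 2] u_pos[of 1] u_pos[of 2]
  have \<Theta>: "0 < \<Theta>" "s $ 1 < \<Theta>" "s $ 2 < \<Theta>" using pos by (auto simp: \<Theta>_def)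
  have fst_v: "- fst (v i) = of_int i * s $ 1 - N i * \<Theta>" for i
    using fst_lattice[of "N i" "i - N i"] by (simp add: v_def \<Theta>_def algebra_simps)
  have N: "N i * \<Theta> \<le> s $ 2 + i * s $ 1" "s $ 2 + i * s $ 1 < (N i + 1) * \<Theta>" for i
    using floor_divide_lower[OF \<Theta>(1)] floor_divide_upper[OF \<Theta>(1)] by (simp_all add: N_def)
  have x_range: "- s $ 2 \<le> - fst (v i)" "- fst (v i) < s $ 1" for i
    using N[of i] by (simp_all add: fst_v \<Theta>_def algebra_simps)
  have N0: "N 0 = 0" using pos \<Theta> by (simp add: N_def floor_eq_iff)
  have v0: "v 0 = 0" by (simp add: v_def N0)
  have "N i \<le> N (i + 1)" for i
    unfolding N_def using pos \<Theta> by (intro floor_mono divide_right_mono) (auto simp: algebra_simps)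
  moreover have "N (i + 1) \<le> N i + 1" for i
  proof -
    have "N (i + 1) \<le> \<lfloor>(s $ 2 + of_int i * s $ 1) / \<Theta> + 1\<rfloor>"
      unfolding N_def using pos \<Theta> by (intro floor_mono) (auto simp: field_simps)
    then show ?thesis by (simp add: N_def)
  qed
  ultimately have N_Suc: "N (i + 1) = N i \<or> N (i + 1) = N i + 1" for i
    by (metis add.commute zle_add1_eq_le order_antisym_conv linorder_not_less)
  have v_Suc: "v (i + 1) = v i + step (w i)" for i
    using N_Suc[of i] by (auto simp: v_def w_def step_def algebra_simps)
  have w1: "w i = 1 \<longleftrightarrow> 0 \<le> - fst (v i)" for i
  proof -
    have "fst (v (i + 1)) = fst (v i) + (if w i = 1 then s $ 2 else - s $ 1)"
      by (simp add: v_Suc fst_step)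
    then show ?thesis using x_range[of i] x_range[of "i + 1"] by (auto split: if_splits)
  qed
  have base: "- fst (v i) \<in> base (w i)" for i
    using x_range[of i] w1[of i] by (auto simp: base_def)
  have "w \<in> intersection_tilings lattice s u"
    unfolding intersection_tilings_def
  proof (rule CollectI, rule exI[of _ "0 :: real"], rule exI[of _ "\<lambda>i. snd (v i)"],
      intro conjI allI ballI impI)
    let ?y = "\<lambda>i. snd (v i)"
    have gap: "?y (i + 1) = ?y i + u $ w i" for i
      by (simp add: v_Suc)
    show "strict_mono ?y"
    proof (rule strict_monoI)
      fix i j :: int
      assume "i < j"
      then show "?y i < ?y j"
      proof (induction j rule: int_gr_induct)
        case base
        show ?case using gap[of i] u_pos[of "w i"] by simp
      next
        case (step j)
        then show ?case using gap[of j] u_pos[of "w j"] by simp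
      qed
    qed
    show "(\<Union>i. {?y i..?y (i + 1)}) = UNIV"
    proof (rule segments_cover_line)
      show "0 < min (u $ 1) (u $ 2)" using pos by simp
      show "?y i + min (u $ 1) (u $ 2) \<le> ?y (i + 1)" for i
        using letter_cases[of "w i"] by (auto simp: gap)
    qed
    show "\<exists>z\<in>lattice. {0} \<times> {?y i..?y (i + 1)} = ({0} \<times> UNIV) \<inter> (+) z ` rect s u (w i)" for i
    proof
      show "v i \<in> lattice" unfolding v_def lattice_iff by blast
      show "{0} \<times> {?y i..?y (i + 1)} = ({0} \<times> UNIV) \<inter> (+) (v i) ` rect s u (w i)"
        using base[of i] unfolding rect_section by (simp add: gap)
    qed
    fix z assume "z \<in> lattice" "fst z = 0"
    then have z: "z = 0" by (rule fst_inj)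
    have "w 0 = 1" using w1[of 0] v0 by simp
    moreover have "w 1 = 2"
    proof -
      have "- fst (v 1) < 0" using v_Suc[of 0] v0 \<open>w 0 = 1\<close> pos by (simp add: fst_step)
      then show ?thesis using w1[of 1] letter_cases[of "w 1"] by auto
    qed
    ultimately show "\<exists>i. ?y i = snd z \<and> ?y (i + 2) = snd z + (u $ 1 + u $ 2) \<and>
        (w i = 1 \<and> w (i + 1) = 2 \<or> w i = 2 \<and> w (i + 1) = 1)"
      using gap[of 0] gap[of 1] by (intro exI[of _ 0]) (simp add: v0 z)
  qed
  moreover have "base x \<subseteq> closure {- fst (v i) | i. w i = x}" for x
  proof -
    have irrational: "s $ 1 / \<Theta> \<notin> \<rat>"
    proof
      assume "s $ 1 / \<Theta> \<in> \<rat>"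
      then obtain a b where ab: "0 < b" "s $ 1 / \<Theta> = of_int a / of_int b"
        by (metis Rats_cases')
      then have "of_int b * s $ 1 = of_int a * \<Theta>"
        using \<Theta> by (simp add: field_simps)
      then have "fst (of_int a *\<^sub>R e_vec s u + of_int (b - a) *\<^sub>R f_vec s u) = 0"
        unfolding fst_lattice by (simp add: \<Theta>_def algebra_simps)
      then have 0: "of_int a *\<^sub>R e_vec s u + of_int (b - a) *\<^sub>R f_vec s u = 0"
        by (intro fst_inj) (auto simp only: lattice_iff)
      then have "a = 0 \<and> b - a = 0"
        using lattice_basis unfolding lattice_basis_def by blast
      with ab show False by simp
    qed
    have "open_base x \<subseteq> closure {- fst (v i) | i. w i = x}"
    proof (rule subsetI, unfold closure_approachable, intro allI impI)
      fix t \<epsilon> :: real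
      assume t: "t \<in> open_base x" and "0 < \<epsilon>"
      have "open (open_base x)" by (simp add: open_base_def)
      with t obtain \<delta> where \<delta>: "0 < \<delta>" "ball t \<delta> \<subseteq> open_base x"
        using open_contains_ball by blast
      have t': "0 \<le> (t + s $ 2) / \<Theta>" "(t + s $ 2) / \<Theta> \<le> 1"
        using t pos by (auto simp: open_base_def \<Theta>_def field_simps split: if_splits)
      have "0 < min \<epsilon> \<delta> / \<Theta>" using \<delta> \<open>0 < \<epsilon>\<close> \<Theta> by simp
      then obtain k where k: "\<bar>frac (real k * (s $ 1 / \<Theta>)) - (t + s $ 2) / \<Theta>\<bar> < min \<epsilon> \<delta> / \<Theta>"
        using Kronecker_approx_1_explicit[OF irrational t'] by metis
      \<comment> \<open>The shift by one turns the starting phase \<open>s $ 2 / \<Theta>\<close> into an integer.\<close>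
      define i where "i = int k + 1"
      have "(s $ 2 + of_int i * s $ 1) / \<Theta> = real k * (s $ 1 / \<Theta>) + 1"
        using \<Theta> by (simp add: i_def \<Theta>_def field_simps)
      then have "N i = \<lfloor>real k * (s $ 1 / \<Theta>)\<rfloor> + 1" by (simp add: N_def)
      then have "- fst (v i) = \<Theta> * frac (real k * (s $ 1 / \<Theta>)) - s $ 2"
        using \<Theta> by (simp add: fst_v frac_def i_def \<Theta>_def field_simps)
      then have "\<bar>- fst (v i) - t\<bar> = \<Theta> * \<bar>frac (real k * (s $ 1 / \<Theta>)) - (t + s $ 2) / \<Theta>\<bar>"
        using \<Theta> by (simp add: abs_mult_pos' field_simps)
      also have "\<dots> < \<Theta> * (min \<epsilon> \<delta> / \<Theta>)"
        using k \<Theta> by (intro mult_strict_left_mono)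
      finally have close: "\<bar>- fst (v i) - t\<bar> < min \<epsilon> \<delta>" using \<Theta> by simp
      then have "- fst (v i) \<in> open_base x"
        using \<delta>(2) by (auto simp: subset_iff dist_real_def abs_minus_commute)
      then have "w i = x"
        using w1[of i] letter_cases[of x] letter_cases[of "w i"]
        by (auto simp: open_base_def split: if_splits)
      with close show "\<exists>y\<in>{- fst (v i) | i. w i = x}. dist y t < \<epsilon>"
        by (auto simp: dist_real_def)
    qed
    then have "closure (open_base x) \<subseteq> closure {- fst (v i) | i. w i = x}"
      by (simp add: closure_minimal)
    moreover have "base x \<subseteq> closure (open_base x)"
      using pos by (auto simp: base_def open_base_def)
    ultimately show ?thesis by blast
  qed
  ultimately show thesis
    using that v0 v_Suc by blast
qed

end

section \<open>Substitutions preserving the tilings are itineraries of a renormalised base\<close>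

text \<open>The hypotheses of the theorem in adapted coordinates: \<open>A\<close> is diagonal, the matrix of \<open>\<tau>\<close> enters only
through \<open>displacement_\<tau>\<close> and \<open>not_commuting\<close>, and hyperbolicity only through \<open>\<mu> \<noteq> 1\<close> and the injectivity of both
coordinates on the lattice.\<close>

locale preserving_substitution = two_rectangles +
  fixes A :: "real \<times> real \<Rightarrow> real \<times> real" and \<kappa> \<mu> :: real and \<tau> :: "letter \<Rightarrow> letter list"
  assumes A_eq: "A v = (\<kappa> * fst v, \<mu> * snd v)"
    and \<kappa>: "\<kappa> \<noteq> 0" and \<mu>: "\<mu> \<noteq> 1" "0 < \<mu>"
    and A_lattice: "A ` lattice = lattice"
    and fst_inj: "v \<in> lattice \<Longrightarrow> fst v = 0 \<Longrightarrow> v = 0"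
    and snd_inj: "v \<in> lattice \<Longrightarrow> snd v = 0 \<Longrightarrow> v = 0"
    and nonempty: "\<tau> x \<noteq> []"
    and displacement_\<tau>: "displacement (\<tau> x) = A (step x)"
    and not_commuting: "\<tau> 1 @ \<tau> 2 \<noteq> \<tau> 2 @ \<tau> 1"
    and preserves: "preserves \<tau> (intersection_tilings lattice s u)"
begin

lemma A_add: "A (v + v') = A v + A v'"
  by (simp add: A_eq algebra_simps)

lemma A_diff: "A (v - v') = A v - A v'"
  by (simp add: A_eq algebra_simps)

text \<open>Let the orbit of 0 be the abscissae of a tiling \<open>w\<close>, and compare it with the orbit that codes a
substituted tiling.  Between the starts of \<open>\<tau> (w i)\<close> and \<open>\<tau> (w (i + 1))\<close> the corner moves by
\<open>A (step (w i))\<close>, so the substituted orbit, sampled at these starts, is the image of the orbit of 0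
under one affine map \<open>t \<mapsto> C + \<kappa> * t\<close>.  Thus \<open>\<tau> x\<close> is read from \<open>C + \<kappa> * t\<close> for a dense set of
points \<open>t\<close> of \<open>base x\<close>, and for all of them because \<open>base\<close> is closed.\<close>

lemma itinerary:
  obtains C where "\<And>x t q. t \<in> base x \<Longrightarrow> q < length (\<tau> x) \<Longrightarrow>
    C + \<kappa> * t - fst (displacement (take q (\<tau> x))) \<in> base (\<tau> x ! q)"
proof -
  obtain w v where w: "w \<in> intersection_tilings lattice s u"
    and v0: "v 0 = 0" and v: "\<And>i. v (i + 1) = v i + step (w i)"
    and dense: "\<And>x. base x \<subseteq> closure {- fst (v i) | i. w i = x}"
    by (rule tiling_through_origin[OF fst_inj]) blast+
  obtain w' p where w': "w' \<in> intersection_tilings lattice s u"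
    and p: "\<And>i. p (i + 1) = p i + int (length (\<tau> (w i)))"
    and word: "\<And>i q. q < length (\<tau> (w i)) \<Longrightarrow> w' (p i + int q) = \<tau> (w i) ! q"
    using preserves w unfolding preserves_def subst_image_def by metis
  obtain c v' where v': "\<And>i. v' (i + 1) = v' i + step (w' i)"
    and x': "\<And>i. c - fst (v' i) \<in> base (w' i)"
    by (rule tiling_itinerary[OF snd_inj w']) blast+
  have jump: "v' (p (i + 1)) = v' (p i) + A (v (i + 1)) - A (v i)" for i
    using tiling_word[OF v' word[of _ i], of "length (\<tau> (w i))"]
    by (simp add: p displacement_\<tau> v A_add)
  have start: "v' (p i) = v' (p 0) + A (v i)" for i
  proof (induction i rule: int_induct[where k = 0])
    case base
    show ?case by (simp add: v0 A_eq zero_prod_def[symmetric])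
  next
    case (step1 i)
    then show ?case using jump[of i] by simp
  next
    case (step2 i)
    then show ?case using jump[of "i - 1"] by (simp add: algebra_simps)
  qed
  define C where "C = c - fst (v' (p 0))"
  show thesis
  proof (rule that[of C])
    fix x t q
    assume t: "t \<in> base x" and q: "q < length (\<tau> x)"
    define d where "d = fst (displacement (take q (\<tau> x)))"
    have "C + \<kappa> * (- fst (v i)) - d \<in> base (\<tau> x ! q)" if "w i = x" for i
    proof -
      have "v' (p i + int q) = v' (p 0) + A (v i) + displacement (take q (\<tau> x))"
        using tiling_word[OF v' word[of _ i], of q] q that start[of i] by simp
      then show ?thesis
        using x'[of "p i + int q"] word[of q i] q that by (simp add: C_def d_def A_eq algebra_simps)
    qed
    then have "{- fst (v i) | i. w i = x} \<subseteq> (\<lambda>t. C + \<kappa> * t - d) -` base (\<tau> x ! q)"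
      by auto
    moreover have "closed ((\<lambda>t. C + \<kappa> * t - d) -` base (\<tau> x ! q))"
      by (intro continuous_closed_vimage closed_base) (auto intro!: continuous_intros)
    ultimately have "closure {- fst (v i) | i. w i = x} \<subseteq> (\<lambda>t. C + \<kappa> * t - d) -` base (\<tau> x ! q)"
      by (rule closure_minimal)
    with dense[of x] t show "C + \<kappa> * t - fst (displacement (take q (\<tau> x))) \<in> base (\<tau> x ! q)"
      unfolding d_def by blast
  qed
qed

text \<open>The endpoint \<open>- fst (step x)\<close> of the interval exchange is reached from 0 by the branch \<open>x\<close> and lies
in the base of the other letter, so both \<open>\<tau> 1 @ \<tau> 2\<close> and \<open>\<tau> 2 @ \<tau> 1\<close> are read from \<open>C\<close>.\<close>

lemma pair_itinerary:
  assumes C: "\<And>x t q. t \<in> base x \<Longrightarrow> q < length (\<tau> x) \<Longrightarrow>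
      C + \<kappa> * t - fst (displacement (take q (\<tau> x))) \<in> base (\<tau> x ! q)"
    and "x \<noteq> y" and q: "q < length (\<tau> x @ \<tau> y)"
  shows "C - fst (displacement (take q (\<tau> x @ \<tau> y))) \<in> base ((\<tau> x @ \<tau> y) ! q)"
proof (cases "q < length (\<tau> x)")
  case True
  then show ?thesis using C[of 0 x q] zero_in_base[of x] by (simp add: nth_append)
next
  case False
  have "- fst (step x) \<in> base y"
    using \<open>x \<noteq> y\<close> letter_cases[of x] letter_cases[of y] s_pos[of 1] s_pos[of 2]
    by (auto simp: fst_step base_def)
  then show ?thesis
    using C[of "- fst (step x)" y "q - length (\<tau> x)"] False q
    by (simp add: nth_append displacement_\<tau> A_eq algebra_simps)
qed

text \<open>Two different words are read upwards from the abscissa \<open>C\<close>, and the interval exchange is ambiguous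
only at 0.  At their first difference the path is therefore at the corner of a translate, which
identifies \<open>C\<close> as the abscissa of a lattice point \<open>p\<close>.  One of the words continues with \<open>ab\<close> and the
other with \<open>ba\<close>: the whole vertical side above \<open>p\<close> is below the end of the words, at height
\<open>\<mu> * (u $ 1 + u $ 2)\<close>.\<close>

lemma branch_point:
  obtains p where "p \<in> lattice" "0 \<le> snd p" "snd p + (u $ 1 + u $ 2) \<le> \<mu> * (u $ 1 + u $ 2)"
    and "\<And>x t q. t \<in> base x \<Longrightarrow> q < length (\<tau> x) \<Longrightarrow>
      fst p + \<kappa> * t - fst (displacement (take q (\<tau> x))) \<in> base (\<tau> x ! q)"
proof -
  obtain C where C: "\<And>x t q. t \<in> base x \<Longrightarrow> q < length (\<tau> x) \<Longrightarrow>
      C + \<kappa> * t - fst (displacement (take q (\<tau> x))) \<in> base (\<tau> x ! q)"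
    using itinerary by blast
  obtain P a r b r' where "a \<noteq> b"
    and split: "\<tau> 1 @ \<tau> 2 = P @ [a] @ r" "\<tau> 2 @ \<tau> 1 = P @ [b] @ r'"
    using same_length_different[OF not_commuting] by auto
  have total: "displacement (\<tau> x @ \<tau> y) = A (step 1 + step 2)" if "x \<noteq> y" for x y
    using that letter_cases[of x] letter_cases[of y]
    by (auto simp: displacement_\<tau> A_add add.commute)
  have len: "length r' = length r"
    using arg_cong[OF split(1), of length] arg_cong[OF split(2), of length] by simp
  have pair: "C - fst (displacement (take q (P @ [a] @ r))) \<in> base ((P @ [a] @ r) ! q)"
    "C - fst (displacement (take q (P @ [b] @ r'))) \<in> base ((P @ [b] @ r') ! q)"
    if "q < length (P @ [a] @ r)" for q
    using pair_itinerary[OF C, of 1 2 q] pair_itinerary[OF C, of 2 1 q] that len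
    unfolding split by simp_all
  have "C - fst (displacement P) \<in> base a \<inter> base b"
    using pair[of "length P"] by simp
  moreover have "base a \<inter> base b = {0}"
    using \<open>a \<noteq> b\<close> letter_cases[of a] letter_cases[of b] s_pos[of 1] s_pos[of 2]
    by (auto simp: base_def)
  ultimately have CP: "C = fst (displacement P)" by simp
  have tot: "displacement (P @ [a] @ r) = A (step 1 + step 2)"
    "displacement (P @ [b] @ r') = A (step 1 + step 2)"
    using total[of 1 2] total[of 2 1] unfolding split by simp_all
  \<comment> \<open>Equal total displacements: the two words cannot differ in their last letter only.\<close>
  have "r \<noteq> []"
  proof
    assume "r = []"
    with tot len have "step a = step b" by (simp flip: tot(2))
    then have "fst (step a) = fst (step b)" by simp
    with \<open>a \<noteq> b\<close> show False
      using letter_cases[of a] letter_cases[of b] s_pos[of 1] s_pos[of 2]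
      by (auto simp: fst_step)
  qed
  then obtain a' r1 b' r1' where r: "r = a' # r1" "r' = b' # r1'"
    using len by (metis length_0_conv list.exhaust)
  have "C - fst (displacement (P @ [a])) \<in> base a'" "C - fst (displacement (P @ [b])) \<in> base b'"
    using pair[of "length P + 1"] by (simp_all add: r nth_append)
  then have "- fst (step a) \<in> base a'"
    by (simp add: CP)
  then have "a' = b"
    using \<open>a \<noteq> b\<close> letter_cases[of a] letter_cases[of b] letter_cases[of a'] s_pos[of 1] s_pos[of 2]
    by (auto simp: fst_step base_def)
  then have "{a, a'} = {1, 2}"
    using \<open>a \<noteq> b\<close> letter_cases[of a] letter_cases[of b] by auto
  then have "u $ a + u $ a' = u $ 1 + u $ 2"
    by (auto simp: doubleton_eq_iff)
  moreover have "snd (displacement (P @ [a] @ r)) = \<mu> * (u $ 1 + u $ 2)"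
    unfolding tot by (simp add: A_eq)
  ultimately have "snd (displacement P) + (u $ 1 + u $ 2) \<le> \<mu> * (u $ 1 + u $ 2)"
    using snd_displacement_nonneg[of r1] by (simp add: r)
  then show thesis
    using that displacement_in_lattice snd_displacement_nonneg C unfolding CP by blast
qed

end

section \<open>Components in the torus\<close>

text \<open>In a partition into open sets each part is also closed, so a connected component that meets a part
lies inside it.\<close>

lemma connected_components_of_open_partition:
  assumes cover: "\<Union>\<C> = topspace X" and disj: "pairwise disjnt \<C>"
    and part: "\<And>C. C \<in> \<C> \<Longrightarrow> openin X C \<and> connectedin X C \<and> C \<noteq> {}"
  shows "connected_components_of X = \<C>"
proof -
  have sub: "C \<in> connected_components_of X" if C: "C \<in> \<C>" for C
  proof -
    obtain x where x: "x \<in> C" using part[OF C] by blast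
    then have "x \<in> topspace X" using cover C by blast
    then obtain D where D: "D \<in> connected_components_of X" "x \<in> D"
      using Union_connected_components_of[of X] by blast
    have CD: "C \<subseteq> D"
      using connected_components_of_maximal[OF D(1), of C] part[OF C] x D(2) by (auto simp: disjnt_iff)
    have "topspace X - C = \<Union>(\<C> - {C})"
      using cover disj C by (auto simp: pairwise_def disjnt_iff)
    moreover have "openin X (\<Union>(\<C> - {C}))" using part by blast
    ultimately have "closedin X C"
      using part[OF C] by (simp add: closedin_def openin_subset)
    then have "D \<subseteq> C"
      using connectedin_clopen_cases[OF connectedin_connected_components_of[OF D(1)]] part[OF C] x D(2)
      by (auto simp: disjnt_iff)
    with CD D(1) show ?thesis by (metis subset_antisym)
  qed
  moreover have "D \<in> \<C>" if D: "D \<in> connected_components_of X" for D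
  proof -
    obtain x where x: "x \<in> D" using nonempty_connected_components_of[OF D] by blast
    then obtain C where "C \<in> \<C>" "x \<in> C"
      using cover connected_components_of_subset[OF D] by blast
    then have "D = C"
      using sub[of C] D x pairwise_disjoint_connected_components_of[of X]
      by (auto simp: pairwise_def disjnt_iff)
    with \<open>C \<in> \<C>\<close> show ?thesis by simp
  qed
  ultimately show ?thesis by blast
qed

lemma staircase_step:
  fixes h :: "nat \<Rightarrow> real"
  assumes "h 0 \<le> y" "y < h n"
  obtains q where "q < n" "h q \<le> y" "y < h (Suc q)"
  using assms
proof (induction n arbitrary: thesis)
  case (Suc n)
  show ?case
  proof (cases "y < h n")
    case True
    then show ?thesis using Suc.IH Suc.prems less_SucI by metis
  next
    case False
    then show ?thesis using Suc.prems by (intro Suc.prems(1)[of n]) auto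
  qed
qed simp

context two_rectangles
begin

lemma torus_proj_eq_iff: "torus_proj lattice x = torus_proj lattice y \<longleftrightarrow> x - y \<in> lattice"
proof
  assume "torus_proj lattice x = torus_proj lattice y"
  then have "x + 0 \<in> (+) y ` lattice"
    using lattice_0 unfolding torus_proj_def by blast
  then show "x - y \<in> lattice" by (simp add: mem_translate)
next
  assume xy: "x - y \<in> lattice"
  have eq: "t - x \<in> lattice \<longleftrightarrow> t - y \<in> lattice" for t
    using lattice_add[OF _ xy, of "t - x"] lattice_diff[OF _ xy, of "t - y"] by auto
  show "torus_proj lattice x = torus_proj lattice y"
    unfolding torus_proj_def by (rule set_eqI) (simp only: mem_translate eq)
qed

lemma topspace_torus: "topspace (torus_topology lattice) = range (torus_proj lattice)"
proof (rule antisym)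
  show "topspace (torus_topology lattice) \<subseteq> range (torus_proj lattice)"
    unfolding topspace_def by (auto simp: openin_torus_topology)
  have "openin (torus_topology lattice) (range (torus_proj lattice))"
    by (auto simp: openin_torus_topology vimage_def)
  then show "range (torus_proj lattice) \<subseteq> topspace (torus_topology lattice)"
    by (rule openin_subset)
qed

lemma torus_proj_vimage: "torus_proj lattice -` torus_proj lattice ` U = (\<Union>v\<in>lattice. (+) v ` U)"
proof (intro set_eqI iffI)
  fix x assume "x \<in> torus_proj lattice -` torus_proj lattice ` U"
  then obtain y where "y \<in> U" "x - y \<in> lattice"
    by (auto simp: torus_proj_eq_iff)
  then show "x \<in> (\<Union>v\<in>lattice. (+) v ` U)"
    by (intro UN_I[of "x - y"]) (auto simp: mem_translate)
next
  fix x assume "x \<in> (\<Union>v\<in>lattice. (+) v ` U)"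
  then obtain v y where "v \<in> lattice" "y \<in> U" "x = v + y" by blast
  then have "torus_proj lattice x = torus_proj lattice y"
    by (simp add: torus_proj_eq_iff)
  then show "x \<in> torus_proj lattice -` torus_proj lattice ` U"
    using \<open>y \<in> U\<close> by blast
qed

lemma openin_torus_proj: "open U \<Longrightarrow> openin (torus_topology lattice) (torus_proj lattice ` U)"
  unfolding openin_torus_topology torus_proj_vimage by (auto intro: open_translation)

lemma connectedin_torus_proj:
  assumes "connected S"
  shows "connectedin (torus_topology lattice) (torus_proj lattice ` S)"
proof (rule connectedin_continuous_map_image)
  show "continuous_map euclidean (torus_topology lattice) (torus_proj lattice)"
    unfolding continuous_map_def
    by (auto simp: topspace_torus openin_torus_topology vimage_def)
qed (use assms in simp)

lemma interior_bi_rect: "interior (bi_rect s u z x) = (+) z ` (open_base x \<times> {0<..<u $ x})"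
  unfolding bi_rect_def by (simp add: interior_translation interior_rect)

lemma bi_rect_section:
  "({c} \<times> UNIV) \<inter> (+) v ` bi_rect s u z x =
    (if c - fst (v + z) \<in> base x then {c} \<times> {snd (v + z)..snd (v + z) + u $ x} else {})"
proof -
  have "(+) v ` bi_rect s u z x = (+) (v + z) ` rect s u x"
    by (simp add: bi_rect_def image_image add.assoc)
  then show ?thesis by (simp only: rect_section)
qed

end

section \<open>The partition cornered at the branch point\<close>

text \<open>From here on \<open>p\<close> is the branch point: the corner of the partition is chosen so that \<open>A\<close> moves the
horizontal spine, up to the lattice vector \<open>p\<close>, into itself.\<close>

locale branch_point_partition = preserving_substitution +
  fixes p :: "real \<times> real"
  assumes p_lattice: "p \<in> lattice" and p_nonneg: "0 \<le> snd p"
    and p_le: "snd p + (u $ 1 + u $ 2) \<le> \<mu> * (u $ 1 + u $ 2)"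
    and itinerary_p: "t \<in> base x \<Longrightarrow> q < length (\<tau> x) \<Longrightarrow>
      fst p + \<kappa> * t - fst (displacement (take q (\<tau> x))) \<in> base (\<tau> x ! q)"
begin

text \<open>The solution of \<open>A z + p = z + (fst p, 0)\<close>: the abscissa 0 keeps the vertical spine on the line of
the origin, and the ordinate is the fixed point of \<open>t \<mapsto> \<mu> * t + snd p\<close>.\<close>

definition corner :: "real \<times> real" where
  "corner = (0, - snd p / (\<mu> - 1))"

text \<open>Translated by \<open>p\<close>, the image of the interior of rectangle \<open>x\<close> is \<open>strip x \<times> {0<..<\<mu> * u $ x}\<close> seen
from the corner, and its pieces are cut out by the heights at which the letters of \<open>\<tau> x\<close> begin.\<close>

definition strip :: "letter \<Rightarrow> real set" where
  "strip x = (\<lambda>t. fst p + \<kappa> * t) ` open_base x"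

definition height :: "letter \<Rightarrow> nat \<Rightarrow> real" where
  "height x q = snd (displacement (take q (\<tau> x)))"

definition piece :: "letter \<Rightarrow> nat \<Rightarrow> (real \<times> real) set" where
  "piece x q = (+) corner ` (strip x \<times> {height x q<..<height x (Suc q)})"

lemma A_corner: "A (corner + v) + p = corner + (fst p + \<kappa> * fst v, \<mu> * snd v)"
  using \<mu> by (simp add: A_eq corner_def prod_eq_iff field_simps)

lemma torus_map_proj: "torus_map A (torus_proj lattice v) = torus_proj lattice (A v + p)"
proof -
  have "torus_map A (torus_proj lattice v) = torus_proj lattice (A v)"
    unfolding torus_map_def torus_proj_def
    by (subst (2) A_lattice[symmetric]) (simp add: image_image A_add)
  also have "\<dots> = torus_proj lattice (A v + p)"
    using lattice_uminus[OF p_lattice] by (simp add: torus_proj_eq_iff)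
  finally show ?thesis .
qed

text \<open>An affine image of an open interval that is contained in a closed interval is contained in the open
one, so paths from the interior of the strip cross the rectangles through their interiors.\<close>

lemma strip_itinerary:
  assumes "t \<in> strip x" "q < length (\<tau> x)"
  shows "t - fst (displacement (take q (\<tau> x))) \<in> open_base (\<tau> x ! q)"
proof -
  let ?d = "fst (displacement (take q (\<tau> x)))"
  have "open ((\<lambda>t. (fst p - ?d) + \<kappa> *\<^sub>R t) ` open_base x)"
    using \<kappa> by (intro open_affinity) (simp add: open_base_def)
  moreover have "(\<lambda>t. (fst p - ?d) + \<kappa> *\<^sub>R t) ` open_base x \<subseteq> base (\<tau> x ! q)"
    using itinerary_p[OF _ assms(2)] open_base_subset by (force simp: algebra_simps)
  ultimately have "(\<lambda>t. (fst p - ?d) + \<kappa> *\<^sub>R t) ` open_base x \<subseteq> open_base (\<tau> x ! q)"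
    unfolding interior_base[symmetric] by (rule interior_maximal[rotated])
  then show ?thesis
    using assms(1) by (force simp: strip_def algebra_simps)
qed

lemma height_simps:
  "height x 0 = 0" "height x (length (\<tau> x)) = \<mu> * u $ x"
  "q < length (\<tau> x) \<Longrightarrow> height x (Suc q) = height x q + u $ (\<tau> x ! q)"
  by (simp_all add: height_def displacement_\<tau> A_eq displacement_take_Suc)

lemma height_mono: "q \<le> q' \<Longrightarrow> height x q \<le> height x q'"
proof (rule lift_Suc_mono_le)
  show "height x n \<le> height x (Suc n)" for n
    using height_simps(3)[of n x] u_pos[of "\<tau> x ! n"]
    by (cases "n < length (\<tau> x)") (auto simp: height_def)
qed

text \<open>The horizontal spine is contracted into itself because every word \<open>\<tau> x\<close> has a first letter.  The
vertical spine is covered by its image by the two inequalities for the height of the branch point.\<close>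

lemma berg_partition: "berg_partition lattice A s u corner"
  unfolding berg_partition_def
proof (intro conjI)
  show "bi_partition_data lattice s u"
    using s_pos u_pos lattice_basis by (simp add: bi_partition_data_def)
  show "torus_map A ` torus_proj lattice ` horizontal_spine s corner
      \<subseteq> torus_proj lattice ` horizontal_spine s corner"
  proof -
    have "torus_map A (torus_proj lattice (corner + (t, 0))) \<in> torus_proj lattice ` horizontal_spine s corner"
      if t: "t \<in> {- s $ 2..s $ 1}" for t
    proof -
      obtain x where "t \<in> base x" using t base_Un by blast
      then have "fst p + \<kappa> * t \<in> base (\<tau> x ! 0)"
        using itinerary_p[of t x 0] nonempty[of x] by simp
      then have "fst p + \<kappa> * t \<in> {- s $ 2..s $ 1}" using base_subset by blast
      then show ?thesis
        unfolding torus_map_proj A_corner horizontal_spine_def by auto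
    qed
    then show ?thesis by (auto simp: horizontal_spine_def)
  qed
  show "torus_proj lattice ` vertical_spine u corner
      \<subseteq> torus_map A ` torus_proj lattice ` vertical_spine u corner"
  proof -
    have "torus_proj lattice (corner + (0, t)) \<in> torus_map A ` torus_proj lattice ` vertical_spine u corner"
      if t: "0 \<le> t" "t \<le> u $ 1 + u $ 2" for t
    proof -
      \<comment> \<open>\<open>A\<close> carries \<open>corner + (0, t')\<close> to \<open>corner + (0, t)\<close> exactly.\<close>
      define t' where "t' = (t + snd p) / \<mu>"
      have t': "\<mu> * t' = t + snd p" using \<mu> by (simp add: t'_def)
      have "t' \<le> (\<mu> * (u $ 1 + u $ 2)) / \<mu>"
        using t p_le \<mu>(2) unfolding t'_def by (intro divide_right_mono) auto
      then have "corner + (0, t') \<in> vertical_spine u corner"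
        using t p_nonneg \<mu> by (auto simp: vertical_spine_def t'_def)
      moreover have "torus_map A (torus_proj lattice (corner + (0, t'))) = torus_proj lattice (corner + (0, t))"
        unfolding torus_map_proj A_corner torus_proj_eq_iff
        using p_lattice by (simp add: t')
      ultimately show ?thesis by (metis imageI)
    qed
    then show ?thesis by (auto simp: vertical_spine_def)
  qed
qed

lemma induces_substitution: "induces_substitution lattice A (bi_rect s u corner) \<tau>"
  unfolding induces_substitution_def
proof (intro allI impI)
  fix x c \<alpha> \<beta>
  assume cross: "crosses c \<alpha> \<beta> (bi_rect s u corner x)"
  then have "\<alpha> < \<beta>" and slice: "{c} \<times> {\<alpha>..\<beta>} = ({c} \<times> UNIV) \<inter> (+) 0 ` bi_rect s u corner x"
    and inside: "{c} \<times> {\<alpha><..<\<beta>} \<subseteq> interior (bi_rect s u corner x)"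
    unfolding crosses_def by auto
  have "(c, (\<alpha> + \<beta>) / 2) \<in> interior (bi_rect s u corner x)"
    using inside \<open>\<alpha> < \<beta>\<close> by auto
  then have c: "c \<in> open_base x"
    unfolding interior_bi_rect by (auto simp: corner_def)
  have "{\<alpha>..\<beta>} = {snd corner..snd corner + u $ x}"
    using slice \<open>\<alpha> < \<beta>\<close> unfolding bi_rect_section by (auto simp: times_eq_iff split: if_splits)
  then have \<alpha>\<beta>: "\<alpha> = snd corner" "\<beta> = snd corner + u $ x"
    using \<open>\<alpha> < \<beta>\<close> by (metis Icc_eq_Icc less_eq_real_def)+
  have \<mu>_corner: "\<mu> * snd corner = snd corner - snd p"
    using A_corner[of 0] by (simp add: A_eq prod_eq_iff)
  have "A ` ({c} \<times> {\<alpha>..\<beta>}) = {\<kappa> * c} \<times> {\<mu> * \<alpha>..\<mu> * \<beta>}"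
  proof -
    have "(\<lambda>t. \<mu> * t) ` {\<alpha>..\<beta>} = {\<mu> * \<alpha>..\<mu> * \<beta>}"
      using \<mu> \<open>\<alpha> < \<beta>\<close> by (simp add: image_mult_atLeastAtMost_if)
    moreover have "A ` ({c} \<times> {\<alpha>..\<beta>}) = {\<kappa> * c} \<times> (\<lambda>t. \<mu> * t) ` {\<alpha>..\<beta>}"
      by (force simp: A_eq image_iff)
    ultimately show ?thesis by simp
  qed
  moreover have "\<mu> * \<alpha> < \<mu> * \<beta>" using \<open>\<alpha> < \<beta>\<close> \<mu> by simp
  moreover have "crossing_word lattice (bi_rect s u corner) (\<kappa> * c) (\<mu> * \<alpha>) (\<mu> * \<beta>) (\<tau> x)"
    unfolding crossing_word_def
  proof (intro exI[of _ "\<lambda>q. \<mu> * \<alpha> + height x q"] conjI allI impI)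
    show "\<mu> * \<alpha> + height x 0 = \<mu> * \<alpha>" "\<mu> * \<alpha> + height x (length (\<tau> x)) = \<mu> * \<beta>"
      by (simp_all add: height_simps \<alpha>\<beta> algebra_simps)
    fix q assume q: "q < length (\<tau> x)"
    let ?g = "displacement (take q (\<tau> x))"
    have "fst p + \<kappa> * c - fst ?g \<in> open_base (\<tau> x ! q)"
      using strip_itinerary[OF _ q, of "fst p + \<kappa> * c"] c unfolding strip_def by blast
    then have inner: "\<kappa> * c - fst (?g - p + corner) \<in> open_base (\<tau> x ! q)"
      by (simp add: corner_def algebra_simps)
    have bottom: "\<mu> * \<alpha> + height x q = snd (?g - p + corner)"
      by (simp add: \<alpha>\<beta> \<mu>_corner height_def)
    have "crosses (\<kappa> * c) (\<mu> * \<alpha> + height x q) (\<mu> * \<alpha> + height x (Suc q))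
        ((+) (?g - p) ` bi_rect s u corner (\<tau> x ! q))"
      unfolding crosses_def
    proof (intro conjI)
      show "\<mu> * \<alpha> + height x q < \<mu> * \<alpha> + height x (Suc q)"
        using u_pos by (simp add: height_simps q)
      show "{\<kappa> * c} \<times> {\<mu> * \<alpha> + height x q..\<mu> * \<alpha> + height x (Suc q)} =
          ({\<kappa> * c} \<times> UNIV) \<inter> (+) (?g - p) ` bi_rect s u corner (\<tau> x ! q)"
        using inner open_base_subset[of "\<tau> x ! q"] bottom
        unfolding bi_rect_section by (auto simp: height_simps q)
      show "{\<kappa> * c} \<times> {\<mu> * \<alpha> + height x q<..<\<mu> * \<alpha> + height x (Suc q)}
          \<subseteq> interior ((+) (?g - p) ` bi_rect s u corner (\<tau> x ! q))"
        using inner bottom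
        unfolding interior_translation interior_bi_rect image_image
        by (auto simp: mem_translate[where v = "?g - p + corner"] mem_Times_iff height_simps q
            simp flip: add.assoc)
    qed
    then show "\<exists>v\<in>lattice. crosses (\<kappa> * c) (\<mu> * \<alpha> + height x q) (\<mu> * \<alpha> + height x (Suc q))
        ((+) v ` bi_rect s u corner (\<tau> x ! q))"
      using lattice_diff[OF displacement_in_lattice p_lattice] by blast
  qed
  ultimately show "\<exists>c' \<alpha>' \<beta>'. \<alpha>' < \<beta>' \<and> A ` ({c} \<times> {\<alpha>..\<beta>}) = {c'} \<times> {\<alpha>'..\<beta>'} \<and>
      crossing_word lattice (bi_rect s u corner) c' \<alpha>' \<beta>' (\<tau> x)"
    by blast
qed

lemma image_interior:
  "(\<lambda>v. A v + p) ` interior (bi_rect s u corner x) = (+) corner ` (strip x \<times> {0<..<\<mu> * u $ x})"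
proof -
  have "(\<lambda>t. \<mu> * t) ` {0<..<u $ x} = {0<..<\<mu> * u $ x}"
  proof (intro set_eqI iffI)
    fix t assume "t \<in> {0<..<\<mu> * u $ x}"
    then show "t \<in> (\<lambda>t. \<mu> * t) ` {0<..<u $ x}"
      using \<mu> by (intro image_eqI[of _ _ "t / \<mu>"]) (auto simp: field_simps)
  qed (use \<mu> in auto)
  moreover have "(\<lambda>v. A v + p) ` interior (bi_rect s u corner x) =
      (+) corner ` (strip x \<times> (\<lambda>t. \<mu> * t) ` {0<..<u $ x})"
    unfolding interior_bi_rect image_image A_corner strip_def
    by (force simp: image_iff)
  ultimately show ?thesis by simp
qed

text \<open>The interior of a rectangle embeds into the torus, and the map induced by \<open>A\<close> there is injective.\<close>

lemma inj_on_image_interior: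
  assumes "t \<in> (\<lambda>v. A v + p) ` interior (bi_rect s u corner x)"
    and "t' \<in> (\<lambda>v. A v + p) ` interior (bi_rect s u corner x)" and "t - t' \<in> lattice"
  shows "t = t'"
proof -
  obtain a a' where a: "a \<in> interior (bi_rect s u corner x)" "t = A a + p"
    and a': "a' \<in> interior (bi_rect s u corner x)" "t' = A a' + p"
    using assms by blast
  have "A (a - a') \<in> A ` lattice"
    using assms(3) a(2) a'(2) by (simp add: A_lattice A_diff)
  then obtain v where "v \<in> lattice" "A (a - a') = A v" by blast
  then have "a - a' = v"
    using \<kappa> \<mu> by (simp add: A_eq prod_eq_iff)
  with \<open>v \<in> lattice\<close> have "a - a' \<in> lattice" by simp
  moreover have "fst a - fst corner - fst (a - a') \<in> open_base x"
    "fst a - fst corner - fst (0 :: real \<times> real) \<in> open_base x"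
    "snd a - snd corner - snd (a - a') \<in> {0..<u $ x}"
    "snd a - snd corner - snd (0 :: real \<times> real) \<in> {0..<u $ x}"
    using a(1) a'(1) by (auto simp: interior_bi_rect)
  ultimately have "a - a' = 0"
    using translate_unique[OF _ lattice_0] by blast
  then show ?thesis using a a' by simp
qed

lemma piece_subset: "q < length (\<tau> x) \<Longrightarrow> piece x q \<subseteq> (\<lambda>v. A v + p) ` interior (bi_rect s u corner x)"
  using height_mono[of 0 q x] height_mono[of "Suc q" "length (\<tau> x)" x]
  unfolding piece_def image_interior by (force simp: height_simps)

lemma piece_properties:
  assumes "q < length (\<tau> x)"
  shows "open (piece x q)" "connected (piece x q)" "piece x q \<noteq> {}"
proof -
  have "open ((\<lambda>t. fst p + \<kappa> *\<^sub>R t) ` open_base x)"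
    using \<kappa> by (intro open_affinity) (simp add: open_base_def)
  then show "open (piece x q)"
    unfolding piece_def strip_def by (auto intro!: open_translation open_Times)
  have "connected (strip x)"
    unfolding strip_def
    by (intro connected_continuous_image continuous_intros) (simp add: open_base_def)
  then show "connected (piece x q)"
    unfolding piece_def
    by (intro connected_continuous_image continuous_intros connected_Times) simp_all
  show "piece x q \<noteq> {}"
    using s_pos[of 1] s_pos[of 2] u_pos[of "\<tau> x ! q"]
    by (simp add: piece_def strip_def open_base_def height_simps assms)
qed

text \<open>A point of the image rectangle lies in a half-open translate for exactly one position \<open>q\<close> of the
word \<open>\<tau> x\<close>, and by \<open>translate_unique\<close> it can lie in the interior of a translate of rectangle \<open>y\<close>
only if that letter is \<open>y\<close> and the point is above the bottom edge.\<close>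

lemma image_Int:
  "torus_map A ` torus_proj lattice ` interior (bi_rect s u corner x)
      \<inter> torus_proj lattice ` interior (bi_rect s u corner y)
    = (\<Union>q\<in>{q. q < length (\<tau> x) \<and> \<tau> x ! q = y}. torus_proj lattice ` piece x q)" (is "?L = ?R")
proof -
  have L: "?L = torus_proj lattice ` (\<lambda>v. A v + p) ` interior (bi_rect s u corner x)
      \<inter> torus_proj lattice ` interior (bi_rect s u corner y)"
    by (simp add: image_image torus_map_proj)
  show ?thesis
  proof (intro equalityI subsetI)
    fix P assume "P \<in> ?L"
    then have "P \<in> torus_proj lattice ` (+) corner ` (strip x \<times> {0<..<\<mu> * u $ x})"
      and P: "P \<in> torus_proj lattice ` interior (bi_rect s u corner y)"
      unfolding L image_interior by simp_all
    then obtain X Y where X: "X \<in> strip x" and Y: "0 < Y" "Y < \<mu> * u $ x"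
      and PXY: "P = torus_proj lattice (corner + (X, Y))"
      by auto
    define t where "t = corner + (X, Y)"
    have t: "P = torus_proj lattice t" "t = corner + (X, Y)" by (simp_all add: PXY t_def)
    from P obtain X' Y' where r: "X' \<in> open_base y" "0 < Y'" "Y' < u $ y"
      and tr: "t - (corner + (X', Y')) \<in> lattice"
      unfolding interior_bi_rect t(1) by (auto simp: torus_proj_eq_iff)
    define v where "v = (X, Y) - (X', Y')"
    have v: "v \<in> lattice" using tr by (simp add: t(2) v_def)
    obtain q where q: "q < length (\<tau> x)" "height x q \<le> Y" "Y < height x (Suc q)"
      using staircase_step[of "height x" Y "length (\<tau> x)"] Y by (auto simp: height_simps)
    have "v = displacement (take q (\<tau> x)) \<and> y = \<tau> x ! q"
    proof (rule translate_unique[OF v displacement_in_lattice])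
      show "X - fst (displacement (take q (\<tau> x))) \<in> open_base (\<tau> x ! q)"
        by (rule strip_itinerary[OF X q(1)])
      show "Y - snd (displacement (take q (\<tau> x))) \<in> {0..<u $ (\<tau> x ! q)}"
        using q by (simp add: height_simps) (simp add: height_def)
    qed (use r in \<open>auto simp: v_def\<close>)
    then have y: "\<tau> x ! q = y" and "height x q = Y - Y'"
      unfolding height_def by (metis, metis diff_Pair snd_conv v_def)
    then have "t \<in> piece x q"
      using X q r by (auto simp: t(2) piece_def)
    then show "P \<in> ?R" using q(1) y t(1) by blast
  next
    fix P assume "P \<in> ?R"
    then obtain q t where q: "q < length (\<tau> x)" "\<tau> x ! q = y" and t: "t \<in> piece x q" "P = torus_proj lattice t"
      by blast
    let ?g = "displacement (take q (\<tau> x))"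
    have "t - ?g \<in> interior (bi_rect s u corner y)"
    proof -
      obtain X Y where tXY: "t = corner + (X, Y)" and X: "X \<in> strip x"
        and Y: "snd ?g < Y" "Y < snd ?g + u $ y"
        using t(1) q(2) by (auto simp: piece_def height_simps(3)[OF q(1)]) (auto simp: height_def)
      have "t - ?g = corner + (X - fst ?g, Y - snd ?g)"
        by (simp add: tXY prod_eq_iff)
      then show ?thesis
        using strip_itinerary[OF X q(1)] Y by (auto simp: interior_bi_rect q(2))
    qed
    moreover have "P = torus_proj lattice (t - ?g)"
      using displacement_in_lattice by (simp add: t(2) torus_proj_eq_iff)
    ultimately show "P \<in> ?L"
      unfolding L using piece_subset[OF q(1)] t by blast
  qed
qed

lemma image_components:
  "image_components lattice A (bi_rect s u corner) x y =
    (\<lambda>q. torus_proj lattice ` piece x q) ` {q. q < length (\<tau> x) \<and> \<tau> x ! q = y}"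
  and inj_on_pieces: "inj_on (\<lambda>q. torus_proj lattice ` piece x q) {q. q < length (\<tau> x) \<and> \<tau> x ! q = y}"
proof -
  let ?I = "{q. q < length (\<tau> x) \<and> \<tau> x ! q = y}" and ?N = "\<lambda>q. torus_proj lattice ` piece x q"
  let ?S = "\<Union>(?N ` ?I)"
  have disj: "disjnt (?N q) (?N q')" if "q < length (\<tau> x)" "q' < length (\<tau> x)" "q \<noteq> q'" for q q'
  proof (rule ccontr)
    assume "\<not> disjnt (?N q) (?N q')"
    then obtain t t' where t: "t \<in> piece x q" and t': "t' \<in> piece x q'" and tt': "t - t' \<in> lattice"
      by (auto simp: disjnt_iff torus_proj_eq_iff)
    have "t = t'"
      using subsetD[OF piece_subset[OF that(1)] t] subsetD[OF piece_subset[OF that(2)] t'] tt'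
      by (rule inj_on_image_interior)
    with t t' have "t \<in> piece x q" "t \<in> piece x q'" by simp_all
    then have "height x q < height x (Suc q')" "height x q' < height x (Suc q)"
      by (auto simp: piece_def)
    then show False
      using height_mono[of "Suc q" q' x] height_mono[of "Suc q'" q x] that(3) by linarith
  qed
  then show "inj_on ?N ?I"
    using piece_properties(3) unfolding inj_on_def
    by (metis (mono_tags, lifting) disjnt_self_iff_empty image_is_empty mem_Collect_eq)
  show "image_components lattice A (bi_rect s u corner) x y = ?N ` ?I"
    unfolding image_components_def image_Int
  proof (rule connected_components_of_open_partition)
    show "\<Union>(?N ` ?I) = topspace (subtopology (torus_topology lattice) ?S)"
      by (auto simp: topspace_torus)
    show "pairwise disjnt (?N ` ?I)"
      using disj by (auto simp: pairwise_def)
    fix C assume "C \<in> ?N ` ?I"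
    then obtain q where q: "q \<in> ?I" "C = ?N q" by blast
    then have "C \<subseteq> ?S" by blast
    moreover have "openin (torus_topology lattice) C" "connectedin (torus_topology lattice) C" "C \<noteq> {}"
      using q piece_properties[of q x] by (auto intro: openin_torus_proj connectedin_torus_proj)
    ultimately show "openin (subtopology (torus_topology lattice) ?S) C \<and>
        connectedin (subtopology (torus_topology lattice) ?S) C \<and> C \<noteq> {}"
      using openin_subtopology_Int2[of "torus_topology lattice" C ?S]
      by (simp add: connectedin_subtopology Int_absorb1)
  qed
qed

lemma card_image_components:
  "finite (image_components lattice A (bi_rect s u corner) x y)"
  "card (image_components lattice A (bi_rect s u corner) x y) = count_list (\<tau> x) y"
  unfolding image_components card_image[OF inj_on_pieces]
  by (simp_all add: count_list_eq_length_filter length_filter_conv_card eq_commute)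

end

section \<open>Hyperbolic integer matrices\<close>

lemma invertible_int_det:
  fixes F :: "int ^ 2 ^ 2"
  assumes "invertible F"
  shows "\<bar>F $ 1 $ 1 * F $ 2 $ 2 - F $ 1 $ 2 * F $ 2 $ 1\<bar> = 1"
proof -
  obtain G where "F ** G = mat 1" using assms unfolding invertible_def by blast
  then have "det F * det G = 1" by (metis det_I det_mul)
  then have "\<bar>det F\<bar> = 1" by (metis dvd_triv_left zdvd1_eq)
  then show ?thesis by (simp add: det_2)
qed

lemma hyperbolic_eigenvector:
  assumes "hyperbolic F" and "x \<noteq> 0 \<or> y \<noteq> 0"
    and "of_int (F $ 1 $ 1) * x + of_int (F $ 1 $ 2) * y = \<mu> * x"
    and "of_int (F $ 2 $ 1) * x + of_int (F $ 2 $ 2) * y = \<mu> * y"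
  shows "\<bar>\<mu> :: real\<bar> \<noteq> 1"
proof -
  define v :: "complex ^ 2" where "v = (\<chi> i. if i = 1 then of_real x else of_real y)"
  have "v \<noteq> 0" using assms(2) by (auto simp: v_def vec_eq_iff forall_2)
  moreover have "map_matrix of_int F *v v = of_real \<mu> *s v"
    using assms(3,4)[THEN arg_cong[where f = complex_of_real]]
    by (simp add: vec_eq_iff forall_2 matrix_vector_mult_def sum_2 map_matrix_def v_def)
  ultimately show ?thesis
    using assms(1) unfolding hyperbolic_def by (metis norm_of_real)
qed

text \<open>An integer vector orthogonal to a row eigenvector may be taken primitive.  Its image under \<open>F\<close> is
orthogonal too, hence an integer multiple \<open>t\<close> of it; as \<open>t\<close> divides the determinant, it is an
eigenvalue of modulus 1, which a hyperbolic matrix does not have.\<close>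

lemma row_eigenvector_irrational:
  fixes F :: "int ^ 2 ^ 2" and x y \<nu> :: real and a b :: int
  assumes "invertible F" and "hyperbolic F" and "x \<noteq> 0 \<or> y \<noteq> 0"
    and ev: "x * of_int (F $ 1 $ 1) + y * of_int (F $ 2 $ 1) = \<nu> * x"
      "x * of_int (F $ 1 $ 2) + y * of_int (F $ 2 $ 2) = \<nu> * y"
    and orth: "x * of_int a + y * of_int b = 0"
  shows "a = 0 \<and> b = 0"
proof (rule ccontr)
  assume "\<not> (a = 0 \<and> b = 0)"
  then have "gcd a b \<noteq> 0" by simp
  then obtain a' b' where ab: "a = a' * gcd a b" "b = b' * gcd a b" and "coprime a' b'"
    using gcd_coprime_exists by blast
  then obtain h h' where bezout: "h * a' + h' * b' = 1"
    by (metis bezout_int coprime_iff_gcd_eq_1)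
  have "(x * of_int a' + y * of_int b') * of_int (gcd a b) = 0"
    using orth by (subst (asm) ab(1), subst (asm) ab(2)) (simp add: algebra_simps)
  then have orth': "x * of_int a' + y * of_int b' = 0"
    using \<open>gcd a b \<noteq> 0\<close> by (simp del: gcd_eq_0_iff)
  define c d where "c = F $ 1 $ 1 * a' + F $ 1 $ 2 * b'" and "d = F $ 2 $ 1 * a' + F $ 2 $ 2 * b'"
  have "x * of_int c + y * of_int d = \<nu> * (x * of_int a' + y * of_int b')"
  proof -
    have "x * of_int c + y * of_int d = (x * of_int (F $ 1 $ 1) + y * of_int (F $ 2 $ 1)) * of_int a'
        + (x * of_int (F $ 1 $ 2) + y * of_int (F $ 2 $ 2)) * of_int b'"
      by (simp add: c_def d_def algebra_simps)
    then show ?thesis by (simp add: ev algebra_simps)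
  qed
  then have orth'': "x * of_int c + y * of_int d = 0" by (simp add: orth')
  have "x * (of_int c * of_int b' - of_int d * of_int a') = 0"
    "y * (of_int c * of_int b' - of_int d * of_int a') = 0"
    using orth' orth'' by algebra+
  then have "of_int c * of_int b' - of_int d * of_int a' = (0 :: real)"
    using assms(3) by auto
  then have "of_int (c * b') = (of_int (d * a') :: real)" by simp
  then have parallel: "c * b' = d * a'" by (simp only: of_int_eq_iff)
  \<comment> \<open>Bezout coefficients turn the proportionality of a primitive vector into a multiple.\<close>
  define t where "t = h * c + h' * d"
  have t: "c = t * a'" "d = t * b'"
    using parallel bezout unfolding t_def by algebra+
  define \<delta> where "\<delta> = F $ 1 $ 1 * F $ 2 $ 2 - F $ 1 $ 2 * F $ 2 $ 1"
  \<comment> \<open>The characteristic equation of the integer eigenvalue \<open>t\<close>.\<close>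
  have "(t * (F $ 1 $ 1 + F $ 2 $ 2 - t) - \<delta>) * a' = 0" "(t * (F $ 1 $ 1 + F $ 2 $ 2 - t) - \<delta>) * b' = 0"
    using t unfolding c_def d_def \<delta>_def by algebra+
  then have "t * (F $ 1 $ 1 + F $ 2 $ 2 - t) = \<delta>"
    using bezout by auto
  then have "\<bar>t\<bar> = 1"
    using invertible_int_det[OF assms(1)] unfolding \<delta>_def[symmetric]
    by (metis abs_dvd_iff dvd_abs_iff dvd_triv_left zdvd1_eq)
  moreover have "\<bar>real_of_int t\<bar> \<noteq> 1"
  proof (rule hyperbolic_eigenvector[OF assms(2)])
    show "real_of_int a' \<noteq> 0 \<or> real_of_int b' \<noteq> 0" using bezout by auto
  qed (use t in \<open>simp_all only: c_def d_def flip: of_int_mult of_int_add\<close>)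
  ultimately show False by simp
qed

text \<open>Commuting words are powers of a common word, so their letter counts are proportional.\<close>

lemma commuting_words_counts:
  assumes "v @ w = w @ v"
  shows "count_list v a * count_list w b = count_list v b * count_list w a"
proof -
  obtain m n z where "concat (replicate m z) = v" "concat (replicate n z) = w"
    using comm_append_are_replicate[OF assms] by blast
  moreover have "count_list (concat (replicate r z)) c = r * count_list z c" for r c
    by (induction r) auto
  ultimately show ?thesis by (auto simp: ac_simps)
qed

section \<open>Realization of a substitution by a Berg partition\<close>

theorem mainTheorem3:
  fixes F :: "int ^ 2 ^ 2" and s u :: "real ^ 2"
    and L :: "(real \<times> real) set" and A :: "real \<times> real \<Rightarrow> real \<times> real"
    and \<tau> :: "letter \<Rightarrow> letter list"
  assumes "invertible F" and "hyperbolic F" and "\<forall>i j. 0 \<le> F $ i $ j"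
    and "column_eigenvector F s" and "\<forall>i. 0 < s $ i"
    and "row_eigenvector F u" and "\<forall>i. 0 < u $ i"
    and "L = int_span (e_vec s u) (f_vec s u)"
    and "linear A"
    and "A (e_vec s u) = of_int (F $ 1 $ 1) *\<^sub>R e_vec s u + of_int (F $ 2 $ 1) *\<^sub>R f_vec s u"
    and "A (f_vec s u) = of_int (F $ 1 $ 2) *\<^sub>R e_vec s u + of_int (F $ 2 $ 2) *\<^sub>R f_vec s u"
    and "substitution \<tau>" and "has_matrix \<tau> F"
    and "preserves \<tau> (intersection_tilings L s u)"
  shows "\<exists>s' u' z. berg_partition L A s' u' z \<and>
           has_connectivity_matrix L A (bi_rect s' u' z) (transpose F) \<and>
           induces_substitution L A (bi_rect s' u' z) \<tau>"
proof -
  note s_pos = \<open>\<forall>i. 0 < s $ i\<close>[rule_format] and u_pos = \<open>\<forall>i. 0 < u $ i\<close>[rule_format]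
  note Ae = \<open>A (e_vec s u) = _\<close> and Af = \<open>A (f_vec s u) = _\<close>
  interpret two_rectangles s u
    by unfold_locales (rule s_pos, rule u_pos)
  note pos = s_pos[of 1] s_pos[of 2] u_pos[of 1] u_pos[of 2]
  define k l m n where "k = F $ 1 $ 1" and "l = F $ 1 $ 2" and "m = F $ 2 $ 1" and "n = F $ 2 $ 2"
  note F = k_def[symmetric] l_def[symmetric] m_def[symmetric] n_def[symmetric]
  obtain \<nu> where col: "k * s $ 1 + l * s $ 2 = \<nu> * s $ 1" "m * s $ 1 + n * s $ 2 = \<nu> * s $ 2"
    using \<open>column_eigenvector F s\<close>
    by (auto simp: column_eigenvector_def vec_eq_iff forall_2 matrix_vector_mult_def sum_2 map_matrix_def F)
  obtain \<mu> where row: "u $ 1 * k + u $ 2 * m = \<mu> * u $ 1" "u $ 1 * l + u $ 2 * n = \<mu> * u $ 2"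
    using \<open>row_eigenvector F u\<close>
    by (auto simp: row_eigenvector_def vec_eq_iff forall_2 vector_matrix_mult_def sum_2 map_matrix_def F
        mult.commute)
  \<comment> \<open>Pairing the row with the column eigenvector shows that the two eigenvalues agree.\<close>
  have "(\<nu> - \<mu>) * (u $ 1 * s $ 1 + u $ 2 * s $ 2) = 0"
    using col row by algebra
  moreover have "0 < u $ 1 * s $ 1 + u $ 2 * s $ 2"
    using pos by (simp add: add_pos_pos)
  ultimately have col: "k * s $ 1 + l * s $ 2 = \<mu> * s $ 1" "m * s $ 1 + n * s $ 2 = \<mu> * s $ 2"
    using col by auto
  have "\<bar>\<mu>\<bar> \<noteq> 1"
    using hyperbolic_eigenvector[OF \<open>hyperbolic F\<close>, of "s $ 1" "s $ 2" \<mu>] pos col by (simp add: F)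
  then have "\<mu> \<noteq> 1" by auto
  define \<delta> where "\<delta> = k * n - l * m"
  have \<delta>: "\<bar>\<delta>\<bar> = 1"
    using invertible_int_det[OF \<open>invertible F\<close>] by (simp add: \<delta>_def F)
  then have \<delta>\<delta>: "\<delta> * \<delta> = 1" by (auto simp: abs_if split: if_splits)
  \<comment> \<open>The other eigenvalue: its row eigenvector is orthogonal to \<open>s\<close>.\<close>
  define \<kappa> where "\<kappa> = k - m * s $ 1 / s $ 2"
  have \<kappa>: "k * s $ 2 - m * s $ 1 = \<kappa> * s $ 2" "l * s $ 2 - n * s $ 1 = - \<kappa> * s $ 1"
  proof -
    show "k * s $ 2 - m * s $ 1 = \<kappa> * s $ 2"
      using pos by (simp add: \<kappa>_def field_simps)
    then have "(l * s $ 2 - n * s $ 1 + \<kappa> * s $ 1) * s $ 2 = 0"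
      using col by algebra
    then show "l * s $ 2 - n * s $ 1 = - \<kappa> * s $ 1" using pos by simp
  qed
  have "\<kappa> \<noteq> 0"
  proof
    assume "\<kappa> = 0"
    then have "(of_int k * of_int n - of_int l * of_int m) * s $ 2 = 0"
      using \<kappa> by algebra
    then have "real_of_int \<delta> = 0" using pos by (simp add: \<delta>_def)
    with \<delta> show False by simp
  qed
  have A_eq: "A v = (\<kappa> * fst v, \<mu> * snd v)" for v
  proof -
    define D where "D = s $ 1 * u $ 1 + s $ 2 * u $ 2"
    have "D \<noteq> 0" using pos unfolding D_def by (smt (verit) mult_pos_pos)
    then have "v = ((fst v * u $ 2 + snd v * s $ 1) / D) *\<^sub>R e_vec s u
        + ((snd v * s $ 2 - fst v * u $ 1) / D) *\<^sub>R f_vec s u"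
      unfolding prod_eq_iff
      by (simp add: e_vec_def f_vec_def field_simps) (simp add: D_def algebra_simps)
    then obtain a b where v: "v = a *\<^sub>R e_vec s u + b *\<^sub>R f_vec s u" by blast
    have "A (e_vec s u) = (\<kappa> * fst (e_vec s u), \<mu> * snd (e_vec s u))"
      "A (f_vec s u) = (\<kappa> * fst (f_vec s u), \<mu> * snd (f_vec s u))"
      unfolding Ae Af F using \<kappa> row by (simp_all add: e_vec_def f_vec_def algebra_simps)
    moreover have "A v = a *\<^sub>R A (e_vec s u) + b *\<^sub>R A (f_vec s u)"
      unfolding v using \<open>linear A\<close> by (simp add: linear_add linear_scale)
    ultimately show ?thesis by (simp add: v algebra_simps)
  qed
  have A_comb: "A (of_int i *\<^sub>R e_vec s u + of_int j *\<^sub>R f_vec s u) =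
      of_int (k * i + l * j) *\<^sub>R e_vec s u + of_int (m * i + n * j) *\<^sub>R f_vec s u" for i j
    using \<open>linear A\<close> by (simp add: linear_add linear_scale Ae Af F algebra_simps)
  interpret preserving_substitution s u A \<kappa> \<mu> \<tau>
  proof
    show "A v = (\<kappa> * fst v, \<mu> * snd v)" for v by (rule A_eq)
    show "\<kappa> \<noteq> 0" "\<mu> \<noteq> 1" by fact+
    show "0 < \<mu>"
    proof -
      have "0 \<le> k" "0 \<le> m" using assms(3) by (simp_all add: k_def m_def)
      moreover have "k \<noteq> 0 \<or> m \<noteq> 0" using \<delta> by (auto simp: \<delta>_def)
      ultimately have "0 < u $ 1 * k + u $ 2 * m"
        using pos by (auto simp: add_pos_nonneg add_nonneg_pos)
      then show ?thesis using row(1) pos by (simp add: zero_less_mult_iff)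
    qed
    show "A ` lattice = lattice"
    proof (intro equalityI subsetI)
      fix v assume "v \<in> A ` lattice"
      then show "v \<in> lattice" unfolding int_span_def using A_comb by blast
    next
      fix v assume "v \<in> lattice"
      then obtain i j where v: "v = of_int i *\<^sub>R e_vec s u + of_int j *\<^sub>R f_vec s u"
        unfolding lattice_iff by blast
      \<comment> \<open>Cramer's rule; the determinant is its own inverse.\<close>
      define i' j' where "i' = \<delta> * (n * i - l * j)" and "j' = \<delta> * (k * j - m * i)"
      have "k * i' + l * j' = i" "m * i' + n * j' = j"
        using \<delta>\<delta> unfolding i'_def j'_def \<delta>_def by algebra+
      then have "v = A (of_int i' *\<^sub>R e_vec s u + of_int j' *\<^sub>R f_vec s u)"
        unfolding A_comb v by simp
      then show "v \<in> A ` lattice" unfolding int_span_def by blast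
    qed
    show "v = 0" if "v \<in> lattice" "fst v = 0" for v
    proof -
      obtain i j where v: "v = of_int i *\<^sub>R e_vec s u + of_int j *\<^sub>R f_vec s u"
        using \<open>v \<in> lattice\<close> unfolding lattice_iff by blast
      have "i = 0 \<and> j = 0"
      proof (rule row_eigenvector_irrational[OF \<open>invertible F\<close> \<open>hyperbolic F\<close>, where \<nu> = \<kappa>])
        show "s $ 2 \<noteq> 0 \<or> - s $ 1 \<noteq> 0" using pos by simp
        show "s $ 2 * of_int i + - s $ 1 * of_int j = 0"
          using \<open>fst v = 0\<close> unfolding v fst_lattice by (simp add: mult.commute)
      qed (use \<kappa> in \<open>simp_all add: F algebra_simps\<close>)
      then show ?thesis by (simp add: v)
    qed
    show "v = 0" if "v \<in> lattice" "snd v = 0" for v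
    proof -
      obtain i j where v: "v = of_int i *\<^sub>R e_vec s u + of_int j *\<^sub>R f_vec s u"
        using \<open>v \<in> lattice\<close> unfolding lattice_iff by blast
      have "i = 0 \<and> j = 0"
      proof (rule row_eigenvector_irrational[OF \<open>invertible F\<close> \<open>hyperbolic F\<close>, where \<nu> = \<mu>])
        show "u $ 1 \<noteq> 0 \<or> u $ 2 \<noteq> 0" using pos by simp
        show "u $ 1 * of_int i + u $ 2 * of_int j = 0"
          using \<open>snd v = 0\<close> unfolding v snd_lattice by (simp add: mult.commute)
      qed (use row in \<open>simp_all add: F\<close>)
      then show ?thesis by (simp add: v)
    qed
    show "\<tau> x \<noteq> []" for x using \<open>substitution \<tau>\<close> by (simp add: substitution_def)
    have count: "int (count_list (\<tau> j) i) = F $ i $ j" for i j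
      using \<open>has_matrix \<tau> F\<close> by (simp add: has_matrix_def)
    have count_real: "real (count_list (\<tau> j) i) = of_int (F $ i $ j)" for i j
      using count[of j i] by (metis of_int_of_nat_eq)
    show "displacement (\<tau> x) = A (step x)" for x
      using letter_cases[of x] by (auto simp: displacement_count count_real step_def Ae Af)
    show "\<tau> 1 @ \<tau> 2 \<noteq> \<tau> 2 @ \<tau> 1"
    proof
      assume "\<tau> 1 @ \<tau> 2 = \<tau> 2 @ \<tau> 1"
      from arg_cong[OF commuting_words_counts[OF this, of 1 2], of int]
      have "k * n = m * l" by (simp add: count F)
      with \<delta> show False by (simp add: \<delta>_def mult.commute)
    qed
    show "preserves \<tau> (intersection_tilings lattice s u)"
      using assms(8,14) by simp
  qed
  obtain p where "p \<in> lattice" "0 \<le> snd p" "snd p + (u $ 1 + u $ 2) \<le> \<mu> * (u $ 1 + u $ 2)"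
    and "\<And>x t q. t \<in> base x \<Longrightarrow> q < length (\<tau> x) \<Longrightarrow>
      fst p + \<kappa> * t - fst (displacement (take q (\<tau> x))) \<in> base (\<tau> x ! q)"
    by (rule branch_point) blast
  then interpret branch_point_partition s u A \<kappa> \<mu> \<tau> p
    by unfold_locales
  have "has_connectivity_matrix lattice A (bi_rect s u corner) (transpose F)"
    using card_image_components \<open>has_matrix \<tau> F\<close>
    by (simp add: has_connectivity_matrix_def has_matrix_def transpose_def)
  then show ?thesis
    using berg_partition induces_substitution unfolding \<open>L = _\<close> by blast
qed

end
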